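(* Let $G$ be a soluble group of type Bredon-$\mathrm{FP}_\infty$ with respect to the family of all virtually cyclic subgroups of $G$, such that for every element $g\in G$ of infinite order the centralizer $C_G(g)$ is of type $\mathrm{FP}_\infty$. Then $G$ is virtually cyclic.
   Context: A virtually cyclic group is one with a cyclic subgroup of finite index (finite groups are included). Let $\mathcal X=\mathcal{VC}$ be the family of all virtually cyclic subgroups of $G$. The orbit category $\mathcal O_{\mathcal{VC}}G$ has as objects the transitive $G$-sets with stabilizers in $\mathcal{VC}$ and as morphisms the $G$-maps. An $\mathcal O_{\mathcal{VC}}G$-module (Bredon module) is a contravariant functor from $\mathcal O_{\mathcal{VC}}G$ to abelian groups; exactness is defined pointwise. For a $G$-set $\Omega$ with stabilizers in $\mathcal{VC}$, $\mathbb Z[-,\Omega]$ is the $\mathcal O_{\mathcal{VC}}G$-module sending $\Delta$ to the free abelian group on the set of $G$-maps $\Delta\to\Omega$. A projective module is finitely generated if it is a direct summand of $\mathbb Z[-,\Omega]$ for some $\Omega$ with finitely many $G$-orbits and stabilizers in $\mathcal{VC}$. $G$ is of type Bredon-$\mathrm{FP}_n$ with respect to $\mathcal{VC}$ if the constant functor $\mathbb Z$ has a projective resolution $P_*$ over $\mathcal O_{\mathcal{VC}}G$ with $P_i$ finitely generated for all $i\le n$, and of type Bredon-$\mathrm{FP}_\infty$ if it has such a resolution with all $P_i$ finitely generated. Type $\mathrm{FP}_n$, $\mathrm{FP}_\infty$ for a group $H$ is the usual notion for the trivial $\mathbb ZH$-module $\mathbb Z$. *)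

theory Defs
  imports "HOL-Algebra.Algebra"
begin

section \<open>Virtually cyclic groups\<close>

definition virtually_cyclic :: "('g, 'b) monoid_scheme \<Rightarrow> bool" where
  "virtually_cyclic G \<longleftrightarrow>
     (\<exists>C. subgroup C G \<and> cyclic_group (G\<lparr>carrier := C\<rparr>) \<and> finite (rcosets\<^bsub>G\<^esub> C))"

definition vc_subgroups :: "('g, 'b) monoid_scheme \<Rightarrow> 'g set set" where
  "vc_subgroups G = {H. subgroup H G \<and> virtually_cyclic (G\<lparr>carrier := H\<rparr>)}"

definition centralizer :: "('g, 'b) monoid_scheme \<Rightarrow> 'g \<Rightarrow> 'g set" where
  "centralizer G g = {h \<in> carrier G. h \<otimes>\<^bsub>G\<^esub> g = g \<otimes>\<^bsub>G\<^esub> h}"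


section \<open>The orbit category\<close>

type_synonym ('g, 'x) gset = "'x set \<times> ('g \<Rightarrow> 'x \<Rightarrow> 'x)"

definition gset_over :: "('g, 'b) monoid_scheme \<Rightarrow> 'g set set \<Rightarrow> ('g, 'x) gset \<Rightarrow> bool" where
  "gset_over G F W \<longleftrightarrow> group_action G (fst W) (snd W) \<and>
     (\<forall>x\<in>fst W. stabilizer G (snd W) x \<in> F)"

text \<open>Maps are extensional, so that two maps with the same values on the underlying set are equal.\<close>

definition gmaps ::
    "('g, 'b) monoid_scheme \<Rightarrow> ('g, 'x) gset \<Rightarrow> ('g, 'y) gset \<Rightarrow> ('x \<Rightarrow> 'y) set" where
  "gmaps G D W = {f \<in> fst D \<rightarrow>\<^sub>E fst W.
     \<forall>g\<in>carrier G. \<forall>x\<in>fst D. f (snd D g x) = snd W g (f x)}"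

text \<open>Objects of the orbit category. Underlying sets are taken in the type \<open>'g set\<close>, which contains
  the coset spaces, so every transitive \<open>G\<close>-set is isomorphic to one of these. The library's
  \<^locale>\<open>transitive_action\<close> admits the empty set, which is not a transitive \<open>G\<close>-set.\<close>

type_synonym 'g orb = "('g, 'g set) gset"

definition orbit_objs :: "('g, 'b) monoid_scheme \<Rightarrow> 'g set set \<Rightarrow> 'g orb set" where
  "orbit_objs G F = {D. transitive_action G (fst D) (snd D) \<and> fst D \<noteq> {} \<and> gset_over G F D}"


section \<open>Bredon modules\<close>

text \<open>\<open>res M D D' f\<close> is the map \<open>M(D') \<rightarrow> M(D)\<close> induced by \<open>f : D \<rightarrow> D'\<close>. Abelian groups are
  commutative groups in the sense of \<^locale>\<open>comm_group\<close>, hence written multiplicatively.\<close>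

record ('g, 'm) bmod =
  val :: "'g orb \<Rightarrow> 'm monoid"
  res :: "'g orb \<Rightarrow> 'g orb \<Rightarrow> ('g set \<Rightarrow> 'g set) \<Rightarrow> 'm \<Rightarrow> 'm"

definition bredon_module ::
    "('g, 'b) monoid_scheme \<Rightarrow> 'g set set \<Rightarrow> ('g, 'm) bmod \<Rightarrow> bool" where
  "bredon_module G F M \<longleftrightarrow>
     (\<forall>D\<in>orbit_objs G F. comm_group (val M D)) \<and>
     (\<forall>D\<in>orbit_objs G F. \<forall>D'\<in>orbit_objs G F. \<forall>f\<in>gmaps G D D'.
        res M D D' f \<in> hom (val M D') (val M D)) \<and>
     (\<forall>D\<in>orbit_objs G F. \<forall>m\<in>carrier (val M D). res M D D (\<lambda>x\<in>fst D. x) m = m) \<and>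
     (\<forall>D\<in>orbit_objs G F. \<forall>D'\<in>orbit_objs G F. \<forall>D''\<in>orbit_objs G F.
        \<forall>f\<in>gmaps G D D'. \<forall>f'\<in>gmaps G D' D''. \<forall>m\<in>carrier (val M D'').
          res M D D'' (compose (fst D) f' f) m = res M D D' f (res M D' D'' f' m))"

definition bmod_hom ::
    "('g, 'b) monoid_scheme \<Rightarrow> 'g set set \<Rightarrow> ('g, 'm) bmod \<Rightarrow> ('g, 'n) bmod \<Rightarrow>
     ('g orb \<Rightarrow> 'm \<Rightarrow> 'n) set" where
  "bmod_hom G F M N = {t.
     (\<forall>D\<in>orbit_objs G F. t D \<in> hom (val M D) (val N D)) \<and>
     (\<forall>D\<in>orbit_objs G F. \<forall>D'\<in>orbit_objs G F. \<forall>f\<in>gmaps G D D'. \<forall>m\<in>carrier (val M D').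
        t D (res M D D' f m) = res N D D' f (t D' m))}"

definition bmod_epi ::
    "('g, 'b) monoid_scheme \<Rightarrow> 'g set set \<Rightarrow> ('g, 'm) bmod \<Rightarrow> ('g, 'n) bmod \<Rightarrow>
     ('g orb \<Rightarrow> 'm \<Rightarrow> 'n) set" where
  "bmod_epi G F M N = {t \<in> bmod_hom G F M N.
     \<forall>D\<in>orbit_objs G F. t D ` carrier (val M D) = carrier (val N D)}"

definition bmod_iso ::
    "('g, 'b) monoid_scheme \<Rightarrow> 'g set set \<Rightarrow> ('g, 'm) bmod \<Rightarrow> ('g, 'n) bmod \<Rightarrow>
     ('g orb \<Rightarrow> 'm \<Rightarrow> 'n) set" where
  "bmod_iso G F M N = {t \<in> bmod_hom G F M N.
     \<forall>D\<in>orbit_objs G F. t D \<in> iso (val M D) (val N D)}"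

definition const_bmod :: "('g, int) bmod" where
  "const_bmod = \<lparr>val = (\<lambda>_. integer_group), res = (\<lambda>_ _ _ n. n)\<rparr>"

text \<open>The module \<open>\<int>[-,W]\<close>; \<open>f : D \<rightarrow> D'\<close> acts on basis elements by precomposition.\<close>

definition free_bmod ::
    "('g, 'b) monoid_scheme \<Rightarrow> ('g, 'w) gset \<Rightarrow> ('g, ('g set \<Rightarrow> 'w) \<Rightarrow>\<^sub>0 int) bmod" where
  "free_bmod G W =
     \<lparr>val = (\<lambda>D. free_Abelian_group (gmaps G D W)),
      res = (\<lambda>D D' f. frag_extend (\<lambda>h. frag_of (compose (fst D) h f)))\<rparr>"

definition bmod_sum :: "('g, 'm) bmod \<Rightarrow> ('g, 'n) bmod \<Rightarrow> ('g, 'm \<times> 'n) bmod" where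
  "bmod_sum M N =
     \<lparr>val = (\<lambda>D. val M D \<times>\<times> val N D),
      res = (\<lambda>D D' f. map_prod (res M D D' f) (res N D D' f))\<rparr>"

text \<open>A complement of \<open>P\<close> in \<open>Q\<close> is isomorphic to a submodule of \<open>Q\<close>, so it is no restriction to
  let its values live in the same type as those of \<open>Q\<close>.\<close>

definition bmod_summand ::
    "('g, 'b) monoid_scheme \<Rightarrow> 'g set set \<Rightarrow> ('g, 'm) bmod \<Rightarrow> ('g, 'n) bmod \<Rightarrow> bool" where
  "bmod_summand G F P Q \<longleftrightarrow>
     (\<exists>P' :: ('g, 'n) bmod. bredon_module G F P' \<and> bmod_iso G F (bmod_sum P P') Q \<noteq> {})"

text \<open>The lifting property. HOL cannot quantify over types, so the types of the test modules are
  fixed. They suffice: \<open>N\<close> may be \<open>P\<close> itself, and \<open>M\<close> the free module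
  \<open>\<Oplus> \<int>[-,D]\<close> over all pairs \<open>(D, x)\<close> with \<open>x \<in> P(D)\<close>, which maps onto \<open>P\<close>. Hence the property
  makes \<open>P\<close> a direct summand of a free module, and lifting against all epimorphisms follows.\<close>

definition bmod_projective ::
    "('g, 'b) monoid_scheme \<Rightarrow> 'g set set \<Rightarrow> ('g, 'm) bmod \<Rightarrow> bool" where
  "bmod_projective G F P \<longleftrightarrow> bredon_module G F P \<and>
     (\<forall>(M :: ('g, ('g orb \<times> 'm \<times> ('g set \<Rightarrow> 'g set)) \<Rightarrow>\<^sub>0 int) bmod) (N :: ('g, 'm) bmod) p f.
        bredon_module G F M \<and> bredon_module G F N \<and>
        p \<in> bmod_epi G F M N \<and> f \<in> bmod_hom G F P N \<longrightarrow>
        (\<exists>h\<in>bmod_hom G F P M. \<forall>D\<in>orbit_objs G F. \<forall>x\<in>carrier (val P D). p D (h D x) = f D x))"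

text \<open>The \<open>itself\<close> arguments, here and below, name the types over which the existential quantifiers
  for \<open>G\<close>-sets and modules range. A theorem having these properties as hypotheses for arbitrary types
  covers witnesses of every type.\<close>

definition bmod_fg_projective ::
    "'w itself \<Rightarrow> ('g, 'b) monoid_scheme \<Rightarrow> 'g set set \<Rightarrow> ('g, 'm) bmod \<Rightarrow> bool" where
  "bmod_fg_projective _ G F P \<longleftrightarrow> bmod_projective G F P \<and>
     (\<exists>W :: ('g, 'w) gset. gset_over G F W \<and> finite (orbits G (fst W) (snd W)) \<and>
        bmod_summand G F P (free_bmod G W))"

definition bmod_resolution ::
    "('g, 'b) monoid_scheme \<Rightarrow> 'g set set \<Rightarrow> (nat \<Rightarrow> ('g, 'm) bmod) \<Rightarrow>
     (nat \<Rightarrow> 'g orb \<Rightarrow> 'm \<Rightarrow> 'm) \<Rightarrow> ('g orb \<Rightarrow> 'm \<Rightarrow> int) \<Rightarrow> bool" where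
  "bmod_resolution G F P d e \<longleftrightarrow>
     (\<forall>i. bmod_projective G F (P i)) \<and>
     (\<forall>i. d i \<in> bmod_hom G F (P (Suc i)) (P i)) \<and>
     e \<in> bmod_epi G F (P 0) const_bmod \<and>
     (\<forall>D\<in>orbit_objs G F.
        d 0 D ` carrier (val (P 1) D) = kernel (val (P 0) D) (val const_bmod D) (e D) \<and>
        (\<forall>i. d (Suc i) D ` carrier (val (P (Suc (Suc i))) D) =
             kernel (val (P (Suc i)) D) (val (P i) D) (d i D)))"

definition bredon_FP_infty ::
    "'w itself \<Rightarrow> 'm itself \<Rightarrow> ('g, 'b) monoid_scheme \<Rightarrow> 'g set set \<Rightarrow> bool" where
  "bredon_FP_infty _ _ G F \<longleftrightarrow>
     (\<exists>(P :: nat \<Rightarrow> ('g, 'm) bmod) d e. bmod_resolution G F P d e \<and>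
        (\<forall>i. bmod_fg_projective TYPE('w) G F (P i)))"


section \<open>Modules over group rings\<close>

text \<open>As \<^locale>\<open>module\<close>, without commutativity of the ring.\<close>

locale left_module = R?: ring R + M?: abelian_group M
  for R :: "('r, 'c) ring_scheme" (structure) and M :: "('r, 'm) module" (structure) +
  assumes smult_closed:
      "\<lbrakk>a \<in> carrier R; x \<in> carrier M\<rbrakk> \<Longrightarrow> a \<odot>\<^bsub>M\<^esub> x \<in> carrier M"
    and smult_l_distr:
      "\<lbrakk>a \<in> carrier R; b \<in> carrier R; x \<in> carrier M\<rbrakk> \<Longrightarrow>
       (a \<oplus>\<^bsub>R\<^esub> b) \<odot>\<^bsub>M\<^esub> x = a \<odot>\<^bsub>M\<^esub> x \<oplus>\<^bsub>M\<^esub> b \<odot>\<^bsub>M\<^esub> x"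
    and smult_r_distr:
      "\<lbrakk>a \<in> carrier R; x \<in> carrier M; y \<in> carrier M\<rbrakk> \<Longrightarrow>
       a \<odot>\<^bsub>M\<^esub> (x \<oplus>\<^bsub>M\<^esub> y) = a \<odot>\<^bsub>M\<^esub> x \<oplus>\<^bsub>M\<^esub> a \<odot>\<^bsub>M\<^esub> y"
    and smult_assoc1:
      "\<lbrakk>a \<in> carrier R; b \<in> carrier R; x \<in> carrier M\<rbrakk> \<Longrightarrow>
       (a \<otimes>\<^bsub>R\<^esub> b) \<odot>\<^bsub>M\<^esub> x = a \<odot>\<^bsub>M\<^esub> (b \<odot>\<^bsub>M\<^esub> x)"
    and smult_one:
      "x \<in> carrier M \<Longrightarrow> \<one>\<^bsub>R\<^esub> \<odot>\<^bsub>M\<^esub> x = x"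

definition lmod_hom ::
    "('r, 'c) ring_scheme \<Rightarrow> ('r, 'm) module \<Rightarrow> ('r, 'n) module \<Rightarrow> ('m \<Rightarrow> 'n) set" where
  "lmod_hom R M N = {f \<in> hom (add_monoid M) (add_monoid N).
     \<forall>a\<in>carrier R. \<forall>x\<in>carrier M. f (a \<odot>\<^bsub>M\<^esub> x) = a \<odot>\<^bsub>N\<^esub> f x}"

text \<open>As for \<open>bmod_projective\<close>: \<open>N\<close> may be \<open>P\<close>, and \<open>M\<close> the free module on the set of elements
  of \<open>P\<close>.\<close>

definition lmod_projective :: "('r, 'c) ring_scheme \<Rightarrow> ('r, 'm) module \<Rightarrow> bool" where
  "lmod_projective R P \<longleftrightarrow> left_module R P \<and>
     (\<forall>(M :: ('r, 'm \<Rightarrow> 'r) module) (N :: ('r, 'm) module) p f.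
        left_module R M \<and> left_module R N \<and>
        p \<in> lmod_hom R M N \<and> p ` carrier M = carrier N \<and> f \<in> lmod_hom R P N \<longrightarrow>
        (\<exists>h\<in>lmod_hom R P M. \<forall>x\<in>carrier P. p (h x) = f x))"

definition lmod_fg :: "('r, 'c) ring_scheme \<Rightarrow> ('r, 'm) module \<Rightarrow> bool" where
  "lmod_fg R M \<longleftrightarrow> (\<exists>S. finite S \<and> S \<subseteq> carrier M \<and>
     carrier M = {\<Oplus>\<^bsub>M\<^esub>s\<in>S. a s \<odot>\<^bsub>M\<^esub> s | a. a \<in> S \<rightarrow> carrier R})"

definition lmod_resolution ::
    "('r, 'c) ring_scheme \<Rightarrow> ('r, 'z) module \<Rightarrow> (nat \<Rightarrow> ('r, 'm) module) \<Rightarrow>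
     (nat \<Rightarrow> 'm \<Rightarrow> 'm) \<Rightarrow> ('m \<Rightarrow> 'z) \<Rightarrow> bool" where
  "lmod_resolution R Z P d e \<longleftrightarrow>
     (\<forall>i. lmod_projective R (P i)) \<and>
     (\<forall>i. d i \<in> lmod_hom R (P (Suc i)) (P i)) \<and>
     e \<in> lmod_hom R (P 0) Z \<and> e ` carrier (P 0) = carrier Z \<and>
     d 0 ` carrier (P 1) = a_kernel (P 0) Z e \<and>
     (\<forall>i. d (Suc i) ` carrier (P (Suc (Suc i))) = a_kernel (P (Suc i)) (P i) (d i))"

text \<open>The integral group ring: formal finite sums of elements of \<open>H\<close>, multiplied by bilinear
  extension of the multiplication of \<open>H\<close>.\<close>

definition group_ring :: "('g, 'b) monoid_scheme \<Rightarrow> ('g \<Rightarrow>\<^sub>0 int) ring" where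
  "group_ring H =
     \<lparr>carrier = {c. Poly_Mapping.keys c \<subseteq> carrier H},
      monoid.mult = (\<lambda>a b. frag_extend (\<lambda>x. frag_extend (\<lambda>y. frag_of (x \<otimes>\<^bsub>H\<^esub> y)) b) a),
      one = frag_of \<one>\<^bsub>H\<^esub>,
      ring.zero = 0,
      add = (+)\<rparr>"

text \<open>The trivial module: a ring element acts through its augmentation. The \<open>mult\<close> and \<open>one\<close>
  components play no role.\<close>

definition trivial_lmod :: "('g \<Rightarrow>\<^sub>0 int, int) module" where
  "trivial_lmod =
     \<lparr>carrier = UNIV, monoid.mult = (*), one = 1, ring.zero = 0, add = (+),
      smult = (\<lambda>c n. (\<Sum>x\<in>Poly_Mapping.keys c. Poly_Mapping.lookup c x) * n)\<rparr>"

definition FP_infty :: "'m itself \<Rightarrow> ('g, 'b) monoid_scheme \<Rightarrow> bool" where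
  "FP_infty _ H \<longleftrightarrow>
     (\<exists>(P :: nat \<Rightarrow> ('g \<Rightarrow>\<^sub>0 int, 'm) module) d e.
        lmod_resolution (group_ring H) trivial_lmod P d e \<and> (\<forall>i. lmod_fg (group_ring H) (P i)))"

end

theory Submission
  imports Defs
begin

text \<open>Let \<open>P\<^sub>0\<close> be the first term of a projective resolution. It is a direct summand of \<open>\<int>[-,W]\<close> for a
  \<open>G\<close>-set \<open>W\<close> with finitely many orbits, and it maps onto the constant functor \<open>\<int>\<close>. Hence
  \<open>\<int>[G/C,W] \<noteq> 0\<close> for every cyclic subgroup \<open>C\<close>, so \<open>C\<close> fixes a point of \<open>W\<close>. Choosing one
  point in each orbit, every element of \<open>G\<close> is conjugate into one of finitely many virtually
  cyclic stabilisers (\<open>bredon_FP_infty_imp_conjugates_cover\<close>). A soluble group with this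
  covering property is virtually cyclic, by the following argument.

  The covering property passes to quotients, so the proof climbs the derived series: \<open>A\<close> is an
  abelian normal subgroup and \<open>G/A\<close> is already known to be virtually cyclic. If \<open>G/A\<close> is
  finite, then \<open>A\<close> is a union of finitely many virtually cyclic groups, and a pigeonhole
  argument shows that it is virtually cyclic itself (\<open>cyclic_by_finite_if_covered\<close>). If \<open>G/A\<close> is
  infinite, then \<open>A\<langle>t\<rangle>\<close> has finite index for some \<open>t\<close> of infinite order modulo \<open>A\<close>, and the
  point is that \<open>A\<close> must be finite, so that \<open>\<langle>t\<rangle>\<close> has finite index in \<open>G\<close>.

  Write \<open>A\<close> additively, with \<open>\<tau>\<close> for conjugation by \<open>t\<close>. The covering property says two things.
  First, \<open>A\<close> is the union of the \<open>\<tau>\<close>-translates of finitely many virtually cyclic subgroups.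
  Second, the elements of \<open>A t\<^sup>n\<close> fall into boundedly many conjugacy classes, which means that the
  number of \<open>\<tau>\<close>-orbits on \<open>A/(\<tau>\<^sup>n - 1)A\<close> is at most a constant \<open>N\<close> for all \<open>n \<ge> 1\<close>. These two facts
  make \<open>A\<close> finite (\<open>finite_if_cyclic_cover_and_few_orbits\<close>):

  \<^item> By the second fact a chain of subgroups of the form \<open>(\<tau>\<^sup>n - 1)A\<close> has bounded length, so that these
    subgroups have a smallest member \<open>D = (\<tau>\<^sup>n - 1)A\<close> along divisibility of \<open>n\<close>
    (\<open>displacements_stabilise\<close>).
  \<^item> By the first fact \<open>\<tau>\<close> has finitely many orbits on \<open>A/mA\<close>. A monic relation for
    \<open>\<tau>\<close> then shows that \<open>\<tau>\<close> has finite order on \<open>A/mA\<close>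
    (\<open>displacements_subset_of_finite_orbits\<close>), and the minimality of \<open>D\<close> turns this into \<open>D = mD\<close>
    for every \<open>m \<ge> 1\<close> (\<open>powers_displacements\<close>).
  \<^item> The torsion of \<open>A\<close> has bounded exponent, so the divisible group \<open>D\<close> is torsion-free. It is
    the union of the translates of finitely many cyclic groups, which is impossible unless
    \<open>D = 0\<close> (\<open>divisible_lines_trivial\<close>).
  \<^item> Now some power \<open>\<tau>\<^sup>n\<close> is the identity on \<open>A\<close>, and the second fact makes \<open>A\<close> a union of at most
    \<open>N\<close> finite orbits.\<close>

section \<open>Powers and pigeonholes\<close>

lemma nat_pigeonhole:
  fixes f :: "nat \<Rightarrow> 'a"
  assumes "finite F" "\<And>n. f n \<in> F"
  obtains i j where "i < j" "f i = f j"
proof -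
  have "finite (range f)" using assms finite_subset[of "range f" F] by blast
  then have "\<not> inj f" using finite_imageD[of f UNIV] by auto
  then show ?thesis using that unfolding inj_def by (metis linorder_neqE_nat)
qed

lemma (in group) inv_cancel_left:
  assumes "x \<in> carrier G" "z \<in> carrier G"
  shows "inv x \<otimes> (x \<otimes> z) = z" "x \<otimes> (inv x \<otimes> z) = z"
  using assms by (simp_all flip: m_assoc)

lemma (in group) quotient_cancel:
  assumes "p \<in> carrier G" "q \<in> carrier G" "g \<in> carrier G"
  shows "(p \<otimes> g) \<otimes> inv (q \<otimes> g) = p \<otimes> inv q"
  using assms by (simp add: inv_mult_group m_assoc inv_cancel_left)

lemma finite_common_multiple:
  assumes "finite S" and "\<And>x. x \<in> S \<Longrightarrow> \<exists>e>0. P x e"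
    and "\<And>x e k. P x e \<Longrightarrow> P x (e * k)"
  shows "\<exists>e>(0::nat). \<forall>x\<in>S. P x e"
  using assms(1,2)
proof (induction S)
  case empty then show ?case by auto
next
  case (insert x S)
  obtain e where e: "e > 0" "\<forall>x\<in>S. P x e" using insert by auto
  obtain e' where e': "e' > 0" "P x e'" using insert by auto
  have "\<forall>z\<in>insert x S. P z (e * e')"
    using e e' assms(3) by (metis insert_iff mult.commute)
  then show ?case using e e' by (metis nat_0_less_mult_iff)
qed

lemma (in group) nat_pow_int_pow:
  "x \<in> carrier G \<Longrightarrow> (x [^] (i::int)) [^] (n::nat) = x [^] (i * int n)"
  by (simp add: int_pow_pow flip: int_pow_int)

text \<open>In an abelian group \<open>(f b\<^sup>k)\<^sup>e = f\<^sup>e b\<^sup>k\<^sup>e\<close>, so an exponent that moves \<open>f\<close> into \<open>\<langle>b\<rangle>\<close> moves the whole coset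
  \<open>f\<langle>b\<rangle>\<close> into \<open>\<langle>b\<rangle>\<close>. A common multiple serves all pairs.\<close>
lemma (in comm_group) uniform_root:
  assumes P: "finite P" "P \<subseteq> carrier G \<times> carrier G"
    and root: "\<And>f b. (f, b) \<in> P \<Longrightarrow> \<exists>e>(0::nat). \<exists>i::int. f [^] e = b [^] i"
  shows "\<exists>e>(0::nat). \<forall>(f, b)\<in>P. \<forall>k::int. \<exists>j::int. (f \<otimes> b [^] k) [^] e = b [^] j"
proof -
  have PA: "fst x \<in> carrier G" "snd x \<in> carrier G" if "x \<in> P" for x using that P by auto
  have "\<exists>e>(0::nat). \<forall>x\<in>P. x \<in> P \<and> (\<exists>i::int. fst x [^] e = snd x [^] i)"
  proof (rule finite_common_multiple[OF P(1)])
    fix x assume "x \<in> P"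
    then show "\<exists>e>(0::nat). x \<in> P \<and> (\<exists>i::int. fst x [^] e = snd x [^] i)"
      using root[of "fst x" "snd x"] by auto
  next
    fix x and e k :: nat assume "x \<in> P \<and> (\<exists>i::int. fst x [^] e = snd x [^] i)"
    then obtain i :: int where x: "x \<in> P" "fst x [^] e = snd x [^] i" by blast
    then have "fst x [^] (e * k) = snd x [^] (i * int k)"
      using PA[OF x(1)] by (simp flip: nat_pow_pow add: nat_pow_int_pow)
    then show "x \<in> P \<and> (\<exists>i::int. fst x [^] (e * k) = snd x [^] i)" using x by blast
  qed
  then obtain e :: nat where e: "e > 0" "\<And>x. x \<in> P \<Longrightarrow> \<exists>i::int. fst x [^] e = snd x [^] i" by blast
  have "\<exists>j::int. (fst x \<otimes> snd x [^] k) [^] e = snd x [^] j" if x: "x \<in> P" for x and k :: int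
  proof -
    obtain i :: int where i: "fst x [^] e = snd x [^] i" using e(2)[OF x] by blast
    have "(fst x \<otimes> snd x [^] k) [^] e = snd x [^] (i + k * int e)"
      using PA[OF x] by (simp add: i pow_mult_distrib m_comm int_pow_mult nat_pow_int_pow)
    then show ?thesis by blast
  qed
  then show ?thesis using e(1) by (auto simp: case_prod_unfold)
qed

text \<open>The exponents \<open>k\<close> with \<open>b\<^sup>k \<in> H\<close> form a subgroup of \<open>\<int>\<close>, hence are the multiples of a single integer.\<close>
lemma (in group) powers_in_subgroup_generator:
  assumes H: "subgroup H G" and b: "b \<in> carrier G"
  obtains g :: int where "b [^] g \<in> H" "\<And>k::int. b [^] k \<in> H \<Longrightarrow> g dvd k"
proof (cases "\<forall>k::int. b [^] k \<in> H \<longrightarrow> k = 0")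
  case True
  then show ?thesis using that[of 0] subgroup.one_closed[OF H] by auto
next
  case False
  then obtain k0 :: int where k0: "b [^] k0 \<in> H" "k0 \<noteq> 0" by blast
  have "b [^] \<bar>k0\<bar> \<in> H"
    using k0 b H by (auto simp: abs_if int_pow_neg subgroup.m_inv_closed)
  then have ex: "\<exists>n. n > 0 \<and> b [^] int n \<in> H" using k0(2) by (intro exI[of _ "nat \<bar>k0\<bar>"]) auto
  define n where "n = (LEAST n. n > 0 \<and> b [^] int n \<in> H)"
  have n: "n > 0" "b [^] int n \<in> H" using LeastI_ex[OF ex] by (auto simp: n_def)
  have "int n dvd k" if k: "b [^] k \<in> H" for k :: int
  proof -
    have "b [^] (k mod int n) = b [^] k \<otimes> inv ((b [^] int n) [^] (k div int n))"
      using b by (simp add: int_pow_pow flip: int_pow_diff minus_mult_div_eq_mod)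
    also have "\<dots> \<in> H"
      using k n H by (metis subgroup.m_closed subgroup.m_inv_closed subgroup_int_pow_closed)
    finally have "b [^] int (nat (k mod int n)) \<in> H" using n by simp
    moreover have "nat (k mod int n) < n" using n by (simp add: nat_less_iff)
    ultimately have "nat (k mod int n) = 0"
      using not_less_Least[of "nat (k mod int n)" "\<lambda>n. n > 0 \<and> b [^] int n \<in> H"] by (simp add: n_def[symmetric])
    then show ?thesis using n by (simp add: dvd_eq_mod_eq_0)
      (metis nat_0_iff nat_int of_nat_0_less_iff pos_mod_sign order_antisym)
  qed
  then show ?thesis using that n by blast
qed

section \<open>An abelian group with an automorphism\<close>

text \<open>An action of \<open>\<int>\<close>, that is, an automorphism \<open>\<tau> 1\<close> together with all its powers, so that negative
  powers need no inverse functions.\<close>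
locale int_action = comm_group A for A (structure) +
  fixes \<tau> :: "int \<Rightarrow> 'a \<Rightarrow> 'a"
  assumes act_hom: "\<tau> n \<in> hom A A"
    and act_0: "x \<in> carrier A \<Longrightarrow> \<tau> 0 x = x"
    and act_add: "x \<in> carrier A \<Longrightarrow> \<tau> (m + n) x = \<tau> m (\<tau> n x)"
begin

text \<open>In additive notation \<open>\<delta> n\<close> is \<open>\<tau>\<^sup>n - 1\<close>, the set \<open>displacements n\<close> is \<open>(\<tau>\<^sup>n - 1)A\<close>, and \<open>powers m E\<close>
  is \<open>mE\<close>.\<close>
definition \<delta> :: "int \<Rightarrow> 'a \<Rightarrow> 'a" where
  "\<delta> n x = \<tau> n x \<otimes> inv x"

definition invariant :: "'a set \<Rightarrow> bool" where
  "invariant E \<longleftrightarrow> subgroup E A \<and> (\<forall>n. \<forall>x\<in>E. \<tau> n x \<in> E)"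

definition powers :: "nat \<Rightarrow> 'a set \<Rightarrow> 'a set" where
  "powers m E = {x [^] m | x. x \<in> E}"

definition displacements :: "int \<Rightarrow> 'a set" where
  "displacements n = \<delta> n ` carrier A"

lemma act_closed [simp, intro]: "x \<in> carrier A \<Longrightarrow> \<tau> n x \<in> carrier A"
  using act_hom by (auto simp: hom_def)

lemma act_mult: "\<lbrakk>x \<in> carrier A; y \<in> carrier A\<rbrakk> \<Longrightarrow> \<tau> n (x \<otimes> y) = \<tau> n x \<otimes> \<tau> n y"
  using act_hom by (auto simp: hom_def)

lemma act_group_hom: "group_hom A A (\<tau> n)"
  by (intro group_hom.intro group_hom_axioms.intro is_group act_hom)

lemma act_one [simp]: "\<tau> n \<one> = \<one>"
  by (rule group_hom.hom_one[OF act_group_hom])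

lemma act_inv: "x \<in> carrier A \<Longrightarrow> \<tau> n (inv x) = inv (\<tau> n x)"
  by (rule group_hom.hom_inv[OF act_group_hom])

lemma act_nat_pow: "x \<in> carrier A \<Longrightarrow> \<tau> n (x [^] (k::nat)) = \<tau> n x [^] k"
  by (rule group_hom.hom_nat_pow[OF act_group_hom])

lemma act_int_pow: "x \<in> carrier A \<Longrightarrow> \<tau> n (x [^] (k::int)) = \<tau> n x [^] k"
  by (rule group_hom.hom_int_pow[OF act_group_hom])

lemma act_neg_cancel [simp]:
  assumes "x \<in> carrier A" shows "\<tau> (- n) (\<tau> n x) = x" "\<tau> n (\<tau> (- n) x) = x"
  using act_add[OF assms, of "- n" n] act_add[OF assms, of n "- n"] assms by (simp_all add: act_0)

lemma act_comm: "x \<in> carrier A \<Longrightarrow> \<tau> m (\<tau> n x) = \<tau> n (\<tau> m x)"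
  by (metis act_add add.commute)

lemma act_inj: "\<lbrakk>x \<in> carrier A; y \<in> carrier A; \<tau> n x = \<tau> n y\<rbrakk> \<Longrightarrow> x = y"
  by (metis act_neg_cancel(1))

lemma delta_closed [simp, intro]: "x \<in> carrier A \<Longrightarrow> \<delta> n x \<in> carrier A"
  by (simp add: \<delta>_def)

lemma act_eq_delta: "x \<in> carrier A \<Longrightarrow> \<tau> n x = \<delta> n x \<otimes> x"
  by (simp add: \<delta>_def m_assoc)

lemma delta_mult:
  assumes "x \<in> carrier A" "y \<in> carrier A" shows "\<delta> n (x \<otimes> y) = \<delta> n x \<otimes> \<delta> n y"
  using assms by (simp add: \<delta>_def act_mult inv_mult_group m_ac)

lemma delta_group_hom: "group_hom A A (\<delta> n)"
  by (intro group_hom.intro group_hom_axioms.intro is_group) (auto simp: hom_def delta_mult)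

lemma delta_nat_pow: "x \<in> carrier A \<Longrightarrow> \<delta> n (x [^] (k::nat)) = \<delta> n x [^] k"
  by (rule group_hom.hom_nat_pow[OF delta_group_hom])

lemma delta_act: "x \<in> carrier A \<Longrightarrow> \<delta> n (\<tau> m x) = \<tau> m (\<delta> n x)"
  by (simp add: \<delta>_def act_mult act_inv act_comm)

lemma delta_delta: "x \<in> carrier A \<Longrightarrow> \<delta> n (\<delta> m x) = \<delta> m (\<delta> n x)"
  by (simp add: \<delta>_def act_mult act_inv act_comm m_ac inv_mult_group)

lemma delta_add: "x \<in> carrier A \<Longrightarrow> \<delta> (m + n) x = \<delta> m (\<tau> n x) \<otimes> \<delta> n x"
  by (simp add: \<delta>_def act_add m_assoc) (simp flip: m_assoc)

text \<open>The polynomial \<open>\<tau>\<^sup>n\<^sup>k - 1\<close> is a multiple of \<open>\<tau>\<^sup>n - 1\<close>.\<close>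
lemma delta_multiple:
  assumes E: "invariant E" and x: "x \<in> carrier A" and d: "\<delta> n x \<in> E"
  shows "\<delta> (n * int k) x \<in> E"
proof (induction k)
  case 0
  then show ?case using E x by (simp add: \<delta>_def act_0 invariant_def subgroup.one_closed)
next
  case (Suc k)
  have "\<delta> (n * int (Suc k)) x = \<delta> (n * int k + n) x"
    by (simp add: algebra_simps)
  also have "\<dots> = \<tau> n (\<delta> (n * int k) x) \<otimes> \<delta> n x"
    using x by (simp add: delta_add delta_act)
  finally show ?case using Suc d E
    by (simp add: invariant_def subgroup.m_closed)
qed

lemma invariant_displacements: "invariant (displacements n)"
proof -
  have "subgroup (displacements n) A"
    using group_hom.img_is_subgroup[OF delta_group_hom] unfolding displacements_def .
  moreover have "\<tau> m x \<in> displacements n" if "x \<in> displacements n" for m x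
    using that by (auto simp: displacements_def simp flip: delta_act)
  ultimately show ?thesis by (simp add: invariant_def)
qed

lemma displacements_mult: "displacements (n * int k) \<subseteq> displacements n"
  using delta_multiple[OF invariant_displacements] by (auto simp: displacements_def)

lemma invariant_powers:
  assumes "invariant E" shows "invariant (powers m E)"
proof -
  have sub: "subgroup E A" and E: "E \<subseteq> carrier A"
    using assms subgroup.subset by (auto simp: invariant_def)
  have "subgroup (powers m E) A"
  proof (rule subgroupI)
    show "powers m E \<subseteq> carrier A" using E by (auto simp: powers_def)
    show "powers m E \<noteq> {}" using subgroup.one_closed[OF sub] by (auto simp: powers_def)
  next
    fix a assume "a \<in> powers m E"
    then obtain x where "x \<in> E" "a = x [^] m" by (auto simp: powers_def)
    then have "inv a = (inv x) [^] m" "inv x \<in> E"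
      using E sub by (auto simp: nat_pow_inv subgroup.m_inv_closed)
    then show "inv a \<in> powers m E" by (auto simp: powers_def)
  next
    fix a b assume "a \<in> powers m E" "b \<in> powers m E"
    then obtain x y where xy: "x \<in> E" "a = x [^] m" "y \<in> E" "b = y [^] m" by (auto simp: powers_def)
    then have "a \<otimes> b = (x \<otimes> y) [^] m" "x \<otimes> y \<in> E"
      using E sub by (auto simp: subset_iff pow_mult_distrib m_comm subgroup.m_closed)
    then show "a \<otimes> b \<in> powers m E" by (auto simp: powers_def)
  qed
  moreover have "\<tau> n x \<in> powers m E" if x: "x \<in> powers m E" for n x
  proof -
    obtain y where y: "y \<in> E" "x = y [^] m" using x by (auto simp: powers_def)
    then have "\<tau> n x = \<tau> n y [^] m" "\<tau> n y \<in> E"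
      using assms E act_nat_pow by (auto simp: invariant_def)
    then show ?thesis by (auto simp: powers_def)
  qed
  ultimately show ?thesis by (simp add: invariant_def)
qed

lemma invariant_carrier: "invariant (carrier A)"
  by (simp add: invariant_def subgroup_self)

section \<open>The subgroups of displacements stabilise\<close>

text \<open>Otherwise there are arbitrarily long chains \<open>M\<^sub>0 \<supset> M\<^sub>1 \<supset> \<dots> \<supset> M\<^sub>N\<^sub>+\<^sub>1\<close> of subgroups of displacements.
  The differences \<open>M\<^sub>i - M\<^sub>i\<^sub>+\<^sub>1\<close> are invariant under \<open>\<tau>\<close> and under translation by \<open>M\<^sub>N\<^sub>+\<^sub>1\<close>, so they
  contribute different orbits on \<open>A/M\<^sub>N\<^sub>+\<^sub>1\<close>, and there are \<open>N + 1\<close> of them.\<close>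
lemma displacements_stabilise:
  fixes N :: nat
  assumes few_orbits: "\<And>n. n > 0 \<Longrightarrow> \<exists>R. finite R \<and> card R \<le> N \<and> R \<subseteq> carrier A \<and>
      (\<forall>a\<in>carrier A. \<exists>r\<in>R. \<exists>j. \<exists>d\<in>displacements (int n). a = \<tau> j r \<otimes> d)"
  shows "\<exists>n>0. \<forall>m>0. displacements (int (n * m)) = displacements (int n)"
proof (rule ccontr)
  assume "\<not> ?thesis"
  then have ex: "\<exists>m>0. displacements (int (n * m)) \<noteq> displacements (int n)" if "n > 0" for n
    using that by blast
  obtain g where g: "\<And>n. n > 0 \<Longrightarrow> g n > 0 \<and> displacements (int (n * g n)) \<noteq> displacements (int n)"
    using ex by metis
  define f where "f = rec_nat 1 (\<lambda>_ n. n * g n)"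
  have fSuc: "f (Suc i) = f i * g (f i)" for i by (simp add: f_def)
  have fpos: "f i > 0" for i
  proof (induction i)
    case 0 then show ?case by (simp add: f_def)
  next
    case (Suc i) then show ?case using g[of "f i"] by (simp add: fSuc)
  qed
  define M where "M i = displacements (int (f i))" for i
  have MSuc: "M (Suc i) \<subset> M i" for i
    using displacements_mult[of "int (f i)" "g (f i)"] g[OF fpos[of i]]
    unfolding M_def fSuc of_nat_mult by blast
  then have anti: "M j \<subseteq> M i" if "i \<le> j" for i j
    using lift_Suc_antimono_le[of M, OF _ that] MSuc by blast
  have inv: "invariant (M i)" for i by (simp add: M_def invariant_displacements)
  obtain a where a: "\<And>i. a i \<in> M i - M (Suc i)"
    using psubset_imp_ex_mem[OF MSuc] by metis
  have aA: "a i \<in> carrier A" for i using a[of i] by (auto simp: M_def displacements_def)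
  obtain R where R: "finite R" "card R \<le> N" "R \<subseteq> carrier A"
    "\<forall>a\<in>carrier A. \<exists>r\<in>R. \<exists>j. \<exists>d\<in>M (Suc N). a = \<tau> j r \<otimes> d"
    using few_orbits[OF fpos[of "Suc N"]] unfolding M_def by blast
  obtain r j d where r: "\<And>i. r i \<in> R" and d: "\<And>i. d i \<in> M (Suc N)"
    and ar: "\<And>i. a i = \<tau> (j i) (r i) \<otimes> d i"
    using R(4)[rule_format, OF aA] by metis
  have "\<not> inj_on r {0..N}"
  proof
    assume "inj_on r {0..N}"
    then have "card {0..N} \<le> card R" using R r card_inj_on_le[of r "{0..N}" R] by blast
    then show False using R by simp
  qed
  then obtain i i' where ii: "i \<le> N" "i' \<le> N" "i < i'" "r i = r i'"
    using linorder_inj_onI'[of "{0..N}" r] by (metis atLeastAtMost_iff)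
  have sub: "subgroup (M (Suc i)) A" and stab: "\<And>n x. x \<in> M (Suc i) \<Longrightarrow> \<tau> n x \<in> M (Suc i)"
    using inv[of "Suc i"] by (auto simp: invariant_def)
  have dA: "d k \<in> carrier A" and dM: "d k \<in> M (Suc i)" for k
    using d[of k] anti[of "Suc i" "Suc N"] ii(1) sub subgroup.subset by blast+
  have rA: "r k \<in> carrier A" for k using r R by blast
  have "a i' \<in> M (Suc i)" using a[of i'] anti[of "Suc i" i'] ii by auto
  moreover have "\<tau> (j i') (r i') = a i' \<otimes> inv (d i')"
    using ar[of i'] dA rA by (simp add: m_assoc)
  ultimately have "\<tau> (j i') (r i') \<in> M (Suc i)"
    using dM sub by (simp add: subgroup.m_closed subgroup.m_inv_closed)
  then have "r i' \<in> M (Suc i)" using stab[of "\<tau> (j i') (r i')" "- j i'"] rA by simp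
  then have "a i \<in> M (Suc i)" using ar[of i] stab dM sub ii(4) by (simp add: subgroup.m_closed)
  then show False using a by blast
qed

section \<open>Finitely many orbits force finite order\<close>

definition congr :: "'a set \<Rightarrow> 'a \<Rightarrow> 'a \<Rightarrow> bool" where
  "congr E x y \<longleftrightarrow> x \<in> carrier A \<and> y \<in> carrier A \<and> x \<otimes> inv y \<in> E"

text \<open>The subgroup generated by \<open>E\<close> and the first \<open>d\<close> iterates \<open>y, \<tau>y, \<dots>, \<tau>\<^sup>d\<^sup>-\<^sup>1y\<close>. Modulo a subgroup \<open>E\<close>
  that contains \<open>mA\<close> it is finite, however long the window.\<close>
primrec window :: "'a set \<Rightarrow> 'a \<Rightarrow> nat \<Rightarrow> 'a set" where
  "window E y 0 = E"
| "window E y (Suc d) = {w \<otimes> \<tau> (int d) y [^] (k::int) | w k. w \<in> window E y d}"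

lemma window_SucI: "w \<in> window E y d \<Longrightarrow> w \<otimes> \<tau> (int d) y [^] (k::int) \<in> window E y (Suc d)"
  by auto

text \<open>Solves a relation \<open>pq \<equiv> b\<close> for \<open>q\<close>.\<close>
lemma solve_relation:
  assumes "p \<in> carrier A" "q \<in> carrier A" "b \<in> carrier A"
  shows "inv p \<otimes> b \<otimes> ((p \<otimes> q) \<otimes> inv b) = q"
proof -
  have "(p \<otimes> q) \<otimes> inv b = inv b \<otimes> (p \<otimes> q)" using assms by (simp add: m_comm)
  then show ?thesis using assms by (simp only:) (simp add: m_assoc inv_cancel_left)
qed

lemma window_subgroup:
  assumes E: "subgroup E A" and y: "y \<in> carrier A"
  shows "subgroup (window E y d) A"
proof (induction d)
  case 0 then show ?case by (simp add: E)
next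
  case (Suc d)
  let ?c = "\<tau> (int d) y"
  have sub: "subgroup (window E y d) A" and W: "window E y d \<subseteq> carrier A"
    using Suc subgroup.subset by auto
  have c: "?c \<in> carrier A" using y by simp
  show ?case
  proof (rule subgroupI)
    show "window E y (Suc d) \<subseteq> carrier A" using W c by auto
    show "window E y (Suc d) \<noteq> {}" using subgroup.one_closed[OF sub] by auto
  next
    fix a assume "a \<in> window E y (Suc d)"
    then obtain w k where w: "w \<in> window E y d" "a = w \<otimes> ?c [^] (k::int)" by auto
    then have "inv a = inv w \<otimes> ?c [^] (- k)"
      using W c by (simp add: inv_mult_group int_pow_neg m_comm subset_iff)
    then show "inv a \<in> window E y (Suc d)" using w sub by (auto simp: subgroup.m_inv_closed)
  next
    fix a b assume "a \<in> window E y (Suc d)" "b \<in> window E y (Suc d)"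
    then obtain w k w' k' where w: "w \<in> window E y d" "a = w \<otimes> ?c [^] (k::int)"
      "w' \<in> window E y d" "b = w' \<otimes> ?c [^] (k'::int)" by auto
    then have "a \<otimes> b = (w \<otimes> w') \<otimes> ?c [^] (k + k')"
      using W c by (simp add: int_pow_mult m_ac subset_iff)
    then show "a \<otimes> b \<in> window E y (Suc d)" using w sub by (auto simp: subgroup.m_closed)
  qed
qed

lemma window_contains:
  assumes E: "subgroup E A" and y: "y \<in> carrier A" and "i < d"
  shows "\<tau> (int i) y \<in> window E y d"
  using \<open>i < d\<close>
proof (induction d)
  case (Suc d)
  have sub: "subgroup (window E y d) A" using window_subgroup[OF E y] .
  show ?case
  proof (cases "i = d")
    case True
    have "\<one> \<otimes> \<tau> (int d) y [^] (1::int) = \<tau> (int i) y" using y True by simp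
    then show ?thesis using window_SucI[OF subgroup.one_closed[OF sub], of 1] by simp
  next
    case False
    then have "\<tau> (int i) y \<in> window E y d" using Suc by auto
    moreover have "\<tau> (int i) y = \<tau> (int i) y \<otimes> \<tau> (int d) y [^] (0::int)" using y by simp
    ultimately show ?thesis using window_SucI[of "\<tau> (int i) y" E y d 0] by metis
  qed
qed auto

lemma window_incl:
  assumes E: "subgroup E A" and y: "y \<in> carrier A"
  shows "E \<subseteq> window E y d"
proof (induction d)
  case (Suc d)
  have W: "window E y d \<subseteq> carrier A" using window_subgroup[OF E y] subgroup.subset by auto
  have "w = w \<otimes> \<tau> (int d) y [^] (0::int)" if "w \<in> window E y d" for w
    using that W y by auto
  then show ?case using Suc window_SucI[of _ E y d 0] by (metis subset_iff)
qed auto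

lemma window_shift:
  assumes E: "invariant E" and y: "y \<in> carrier A" and "x \<in> window E y d"
  shows "\<tau> 1 x \<in> window E y (Suc d)"
  using assms(3)
proof (induction d arbitrary: x)
  case 0
  have "\<tau> 1 x \<in> E" using 0 E by (auto simp: invariant_def)
  then show ?case using window_incl[of E y "Suc 0"] E y by (auto simp: invariant_def)
next
  case (Suc d)
  have Es: "subgroup E A" using E by (simp add: invariant_def)
  obtain w k where w: "w \<in> window E y d" "x = w \<otimes> \<tau> (int d) y [^] (k::int)"
    using Suc.prems by auto
  have "w \<in> carrier A" using w window_subgroup[OF Es y] subgroup.subset by blast
  then have "\<tau> 1 x = \<tau> 1 w \<otimes> \<tau> (int (Suc d)) y [^] k"
    using w y by (simp add: act_mult act_int_pow act_add)
  then show ?case using Suc.IH[OF w(1)] unfolding window.simps(2)[of E y "Suc d"] by blast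
qed

lemma window_finite:
  fixes m :: nat
  assumes E: "subgroup E A" and y: "y \<in> carrier A" and m: "m > 0"
    and pow: "powers m (carrier A) \<subseteq> E"
  shows "\<exists>F. finite F \<and> F \<subseteq> carrier A \<and> (\<forall>w\<in>window E y d. \<exists>f\<in>F. congr E w f)"
proof (induction d)
  case 0
  have "congr E w \<one>" if "w \<in> E" for w
    using that E subgroup.mem_carrier by (fastforce simp: congr_def)
  then show ?case by (intro exI[of _ "{\<one>}"]) auto
next
  case (Suc d)
  let ?c = "\<tau> (int d) y"
  have c: "?c \<in> carrier A" using y by simp
  have W: "window E y d \<subseteq> carrier A" using window_subgroup[OF E y] subgroup.subset by auto
  have EA: "E \<subseteq> carrier A" using E subgroup.subset by auto
  obtain F where F: "finite F" "F \<subseteq> carrier A" "\<forall>w\<in>window E y d. \<exists>f\<in>F. congr E w f"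
    using Suc by blast
  let ?F = "(\<lambda>(f, j). f \<otimes> ?c [^] (j::int)) ` (F \<times> {0..<int m})"
  have "\<exists>f\<in>?F. congr E x f" if x: "x \<in> window E y (Suc d)" for x
  proof -
    obtain w k where w: "w \<in> window E y d" "x = w \<otimes> ?c [^] (k::int)" using x by auto
    obtain f where f: "f \<in> F" "congr E w f" using F w by blast
    define j q where "j = k mod int m" and "q = k div int m"
    have k: "k = q * int m + j" by (simp add: j_def q_def)
    have wA: "w \<in> carrier A" and fA: "f \<in> carrier A" using w W f F by auto
    have qm: "?c [^] (q * int m) = (?c [^] q) [^] m"
      using int_pow_pow[OF c, of q "int m"] by (simp add: int_pow_int)
    have "x \<otimes> inv (f \<otimes> ?c [^] j) = ((w \<otimes> ?c [^] (q * int m)) \<otimes> ?c [^] j) \<otimes> inv (f \<otimes> ?c [^] j)"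
      using wA c by (simp add: w k int_pow_mult m_assoc)
    also have "\<dots> = (w \<otimes> ?c [^] (q * int m)) \<otimes> inv f"
      using wA fA c by (simp add: quotient_cancel)
    also have "\<dots> = (w \<otimes> inv f) \<otimes> ?c [^] (q * int m)"
      using wA fA c by (simp add: m_ac)
    also have "\<dots> \<in> E"
    proof -
      have "?c [^] (q * int m) \<in> E"
        using pow int_pow_closed[OF c] unfolding qm powers_def by blast
      then show ?thesis using f E by (simp add: congr_def subgroup.m_closed)
    qed
    finally have "congr E x (f \<otimes> ?c [^] j)" using wA fA c by (simp add: congr_def w)
    moreover have "j \<in> {0..<int m}" using m by (simp add: j_def)
    ultimately show ?thesis using f by force
  qed
  moreover have "finite ?F" "?F \<subseteq> carrier A" using F c by auto
  ultimately show ?case by blast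
qed

text \<open>The hypothesis \<open>monic\<close> says that a monic polynomial of degree \<open>d\<close> in \<open>\<tau>\<close> annihilates \<open>y\<close> modulo the
  earlier iterates. It makes the window stable under \<open>\<tau>\<close>, so that all later iterates of \<open>y\<close>
  stay in a set that is finite modulo \<open>E\<close>, and two of them coincide there.\<close>
lemma finite_order_of_window:
  fixes m :: nat
  assumes E: "invariant E" and y: "y \<in> carrier A" and m: "m > 0"
    and pow: "powers m (carrier A) \<subseteq> E"
    and monic: "\<tau> (int d) y \<in> window E y d"
  shows "\<exists>n>0. \<delta> (int n) y \<in> E"
proof -
  have Es: "subgroup E A" using E by (simp add: invariant_def)
  have sub: "subgroup (window E y d) A" and WA: "window E y d \<subseteq> carrier A"
    using window_subgroup[OF Es y] subgroup.subset by blast+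
  have shift: "\<tau> 1 x \<in> window E y d" if x: "x \<in> window E y d" for x
  proof -
    obtain w k where w: "w \<in> window E y d" "\<tau> 1 x = w \<otimes> \<tau> (int d) y [^] (k::int)"
      using window_shift[OF E y x] by auto
    then show ?thesis
      using sub monic by (metis group.subgroup_int_pow_closed is_group subgroup.m_closed)
  qed
  have W: "\<tau> (int i) (\<tau> (int d) y) \<in> window E y d" for i
  proof (induction i)
    case 0 then show ?case using monic y by (simp add: act_0)
  next
    case (Suc i)
    then show ?case using shift[OF Suc] y by (simp add: act_add)
  qed
  obtain F where F: "finite F" "F \<subseteq> carrier A" "\<forall>w\<in>window E y d. \<exists>f\<in>F. congr E w f"
    using window_finite[OF Es y m pow, of d] by blast
  then have "\<forall>i. \<exists>f. f \<in> F \<and> congr E (\<tau> (int i) (\<tau> (int d) y)) f"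
    using W by blast
  then obtain f where f: "\<And>i. f i \<in> F" "\<And>i. congr E (\<tau> (int i) (\<tau> (int d) y)) (f i)"
    by metis
  obtain i i' where i: "i < i'" "f i = f i'" using nat_pigeonhole[of F f] F(1) f(1) by blast
  let ?z = "\<lambda>i. \<tau> (int i) (\<tau> (int d) y)"
  have zA: "?z i \<in> carrier A" for i using y by simp
  have fA: "f i \<in> carrier A" for i using f F by blast
  have "?z i' \<otimes> inv (f i) \<otimes> inv (?z i \<otimes> inv (f i)) \<in> E"
    using f(2)[of i] f(2)[of i'] i Es by (simp add: congr_def subgroup.m_closed subgroup.m_inv_closed)
  also have "?z i' \<otimes> inv (f i) \<otimes> inv (?z i \<otimes> inv (f i)) = ?z i' \<otimes> inv (?z i)"
    using zA[of i] zA[of i'] fA[of i] by (simp add: quotient_cancel)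
  also have "\<dots> = \<tau> (int (i + d)) (\<delta> (int (i' - i)) y)"
  proof -
    have "?z i' = \<tau> (int (i + d)) (\<tau> (int (i' - i)) y)"
      using y i(1) act_add[OF y, of "int i'" "int d"] act_add[OF y, of "int (i + d)" "int (i' - i)"]
      by (simp add: of_nat_diff add.commute)
    moreover have "?z i = \<tau> (int (i + d)) y"
      using y by (simp flip: act_add)
    ultimately show ?thesis using y by (simp add: \<delta>_def act_mult act_inv)
  qed
  finally have "\<tau> (- int (i + d)) (\<tau> (int (i + d)) (\<delta> (int (i' - i)) y)) \<in> E"
    using E unfolding invariant_def by blast
  then have "\<delta> (int (i' - i)) y \<in> E" using y by (simp only: act_neg_cancel delta_closed)
  then show ?thesis using i(1) by (intro exI[of _ "i' - i"]) auto
qed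

lemma delta_act_iff:
  assumes E: "invariant E" and y: "y \<in> carrier A"
  shows "\<delta> n (\<tau> j y) \<in> E \<longleftrightarrow> \<delta> n y \<in> E"
proof
  assume "\<delta> n (\<tau> j y) \<in> E"
  then have "\<tau> (- j) (\<delta> n (\<tau> j y)) \<in> E" using E unfolding invariant_def by blast
  then show "\<delta> n y \<in> E" using y by (simp add: delta_act)
next
  assume "\<delta> n y \<in> E"
  then show "\<delta> n (\<tau> j y) \<in> E" using E y by (simp add: delta_act invariant_def)
qed

text \<open>A suitable relation comes from the elements \<open>x + \<tau>\<^sup>sx\<close> with \<open>s \<ge> 1\<close>. Two of them, for \<open>s < s'\<close>, lie
  in the same orbit modulo \<open>E\<close>, hence \<open>1 + \<tau>\<^sup>s\<^sup>' - \<tau>\<^sup>k - \<tau>\<^sup>k\<^sup>+\<^sup>s\<close> annihilates \<open>x\<close> modulo \<open>E\<close> for some \<open>k\<close>. If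
  \<open>s' \<noteq> k + s\<close>, the larger of these two exponents is the unique highest one, so its coefficient
  is \<open>\<plusminus>1\<close>. If \<open>s' = k + s\<close>, what remains is \<open>1 - \<tau>\<^sup>k\<close> with \<open>k > 0\<close>.\<close>
lemma finite_orbits_imp_finite_order:
  fixes m :: nat
  assumes E: "invariant E" and m: "m > 0"
    and pow: "powers m (carrier A) \<subseteq> E"
    and fin: "finite F" "F \<subseteq> carrier A"
    and cover: "\<forall>a\<in>carrier A. \<exists>f\<in>F. \<exists>n. congr E a (\<tau> n f)"
    and x: "x \<in> carrier A"
  shows "\<exists>n>0. \<delta> (int n) x \<in> E"
proof -
  have Es: "subgroup E A" using E by (simp add: invariant_def)
  have EA: "E \<subseteq> carrier A" using Es subgroup.subset by auto
  let ?z = "\<lambda>s. x \<otimes> \<tau> (int (Suc s)) x"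
  have "\<exists>f\<in>F. \<exists>n. congr E (?z s) (\<tau> n f)" for s using cover x by simp
  then obtain f n where f: "\<And>s. f s \<in> F" "\<And>s. congr E (?z s) (\<tau> (n s) (f s))" by metis
  obtain u v where uv: "u < v" "f u = f v" using nat_pigeonhole[of F f] fin(1) f(1) by blast
  define s s' k where "s = int (Suc u)" and "s' = int (Suc v)" and "k = n v - n u"
  have ss: "0 < s" "s < s'" using uv by (auto simp: s_def s'_def)
  have xA: "\<tau> i x \<in> carrier A" for i using x by simp
  have rel: "(x \<otimes> \<tau> s' x) \<otimes> inv (\<tau> k x \<otimes> \<tau> (k + s) x) \<in> E"
  proof -
    let ?g = "\<tau> (n v) (f v)"
    have fA: "f v \<in> carrier A" using f fin by blast
    then have g: "?g \<in> carrier A" by simp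
    have 1: "(x \<otimes> \<tau> s' x) \<otimes> inv ?g \<in> E" using f(2)[of v] by (simp add: congr_def s'_def)
    have "(x \<otimes> \<tau> s x) \<otimes> inv (\<tau> (n u) (f v)) \<in> E"
      using f(2)[of u] uv by (simp add: congr_def s_def)
    then have "\<tau> k ((x \<otimes> \<tau> s x) \<otimes> inv (\<tau> (n u) (f v))) \<in> E" using E unfolding invariant_def by blast
    also have "\<tau> k ((x \<otimes> \<tau> s x) \<otimes> inv (\<tau> (n u) (f v))) = (\<tau> k x \<otimes> \<tau> (k + s) x) \<otimes> inv ?g"
      using x fA act_add[OF fA, of k "n u"] by (simp add: act_mult act_inv act_add k_def)
    finally have 2: "(\<tau> k x \<otimes> \<tau> (k + s) x) \<otimes> inv ?g \<in> E" .
    have "((x \<otimes> \<tau> s' x) \<otimes> inv ?g) \<otimes> inv ((\<tau> k x \<otimes> \<tau> (k + s) x) \<otimes> inv ?g) \<in> E"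
      using 1 2 Es by (simp add: subgroup.m_closed subgroup.m_inv_closed)
    also have "((x \<otimes> \<tau> s' x) \<otimes> inv ?g) \<otimes> inv ((\<tau> k x \<otimes> \<tau> (k + s) x) \<otimes> inv ?g)
        = (x \<otimes> \<tau> s' x) \<otimes> inv (\<tau> k x \<otimes> \<tau> (k + s) x)"
      using x g xA by (simp add: quotient_cancel)
    finally show ?thesis .
  qed
  show ?thesis
  proof (cases "s' = k + s")
    case True
    then have "x \<otimes> inv (\<tau> k x) \<in> E"
      using rel x xA[of k] xA[of "k + s"] by (simp add: quotient_cancel)
    then have "inv (x \<otimes> inv (\<tau> k x)) \<in> E" using Es by (simp add: subgroup.m_inv_closed)
    also have "inv (x \<otimes> inv (\<tau> k x)) = \<delta> (int (nat k)) x"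
      using True ss x by (simp add: inv_mult_group \<delta>_def)
    finally show ?thesis using True ss by (intro exI[of _ "nat k"]) auto
  next
    case False
    \<comment> \<open>The exponent \<open>k\<close> may be negative. Passing from \<open>x\<close> to \<open>y\<close> makes all exponents nonnegative.\<close>
    define K where "K = nat \<bar>k\<bar>"
    define y where "y = \<tau> (- int K) x"
    have y: "y \<in> carrier A" using x by (simp add: y_def)
    have sh: "\<tau> i x = \<tau> (int (nat (i + int K))) y" if "i \<ge> - int K" for i
      using that x by (simp add: y_def flip: act_add)
    have inW: "\<tau> i x \<in> window E y d" if "i \<ge> - int K" "i + int K < int d" for i d
      using window_contains[OF Es y, of "nat (i + int K)" d] that sh[of i] by simp
    have Kk: "- int K \<le> k" "- int K \<le> 0" "- int K \<le> k + s" "- int K \<le> s'"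
      using ss by (auto simp: K_def)
    have x0: "\<tau> 0 x = x" using x by (simp add: act_0)
    have "\<exists>d. \<tau> (int d) y \<in> window E y d"
    proof (cases "k + s < s'")
      case True
      let ?d = "nat (s' + int K)"
      have W: "subgroup (window E y ?d) A" "E \<subseteq> window E y ?d"
        using window_subgroup[OF Es y] window_incl[OF Es y] by blast+
      have m: "x \<in> window E y ?d" "\<tau> k x \<in> window E y ?d" "\<tau> (k + s) x \<in> window E y ?d"
        using inW[of 0 ?d] inW[of k ?d] inW[of "k + s" ?d] True ss Kk x0 by auto
      have "inv x \<otimes> (\<tau> k x \<otimes> \<tau> (k + s) x) \<otimes>
          ((x \<otimes> \<tau> s' x) \<otimes> inv (\<tau> k x \<otimes> \<tau> (k + s) x)) \<in> window E y ?d"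
        using W rel m by (meson subgroup.m_closed subgroup.m_inv_closed subsetD)
      also have "inv x \<otimes> (\<tau> k x \<otimes> \<tau> (k + s) x) \<otimes>
          ((x \<otimes> \<tau> s' x) \<otimes> inv (\<tau> k x \<otimes> \<tau> (k + s) x)) = \<tau> s' x"
        using x xA by (simp add: solve_relation)
      also have "\<tau> s' x = \<tau> (int ?d) y" using sh Kk by blast
      finally show ?thesis by blast
    next
      case nless: False
      let ?d = "nat (k + s + int K)"
      have W: "subgroup (window E y ?d) A" "E \<subseteq> window E y ?d"
        using window_subgroup[OF Es y] window_incl[OF Es y] by blast+
      have m: "x \<in> window E y ?d" "\<tau> k x \<in> window E y ?d" "\<tau> s' x \<in> window E y ?d"
        using inW[of 0 ?d] inW[of k ?d] inW[of "s'" ?d] nless False ss Kk x0 by auto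
      have "inv (\<tau> k x) \<otimes> (x \<otimes> \<tau> s' x) \<otimes>
          inv ((x \<otimes> \<tau> s' x) \<otimes> inv (\<tau> k x \<otimes> \<tau> (k + s) x)) \<in> window E y ?d"
        using W rel m by (meson subgroup.m_closed subgroup.m_inv_closed subsetD)
      also have "inv ((x \<otimes> \<tau> s' x) \<otimes> inv (\<tau> k x \<otimes> \<tau> (k + s) x)) =
          (\<tau> k x \<otimes> \<tau> (k + s) x) \<otimes> inv (x \<otimes> \<tau> s' x)"
        using x xA inv_mult_group[of "x \<otimes> \<tau> s' x" "inv (\<tau> k x \<otimes> \<tau> (k + s) x)"]
        by (simp del: inv_mult_group)
      also have "inv (\<tau> k x) \<otimes> (x \<otimes> \<tau> s' x) \<otimes>
          ((\<tau> k x \<otimes> \<tau> (k + s) x) \<otimes> inv (x \<otimes> \<tau> s' x)) = \<tau> (k + s) x"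
        using x xA by (simp add: solve_relation)
      also have "\<tau> (k + s) x = \<tau> (int ?d) y" using sh Kk by blast
      finally show ?thesis by blast
    qed
    then obtain d where "\<tau> (int d) y \<in> window E y d" by blast
    then have "\<exists>n>0. \<delta> (int n) y \<in> E" by (rule finite_order_of_window[OF E y m pow])
    then show ?thesis using delta_act_iff[OF E x] by (simp add: y_def)
  qed
qed

lemma displacements_subset_of_finite_orbits:
  fixes m :: nat
  assumes E: "invariant E" and m: "m > 0"
    and pow: "powers m (carrier A) \<subseteq> E"
    and fin: "finite F" "F \<subseteq> carrier A"
    and cover: "\<forall>a\<in>carrier A. \<exists>f\<in>F. \<exists>n. congr E a (\<tau> n f)"
  shows "\<exists>n>0. displacements (int n) \<subseteq> E"
proof -
  have Es: "subgroup E A" using E by (simp add: invariant_def)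
  have ex: "\<exists>n>0. \<delta> (int n) x \<in> E" if "x \<in> carrier A" for x
    by (rule finite_orbits_imp_finite_order[OF E m pow fin cover that])
  have "\<exists>n>0. \<forall>f\<in>F'. \<delta> (int n) f \<in> E" if "finite F'" "F' \<subseteq> carrier A" for F'
    using that
  proof (induction F')
    case empty then show ?case by auto
  next
    case (insert x F')
    obtain n where n: "n > 0" "\<forall>f\<in>F'. \<delta> (int n) f \<in> E" using insert by auto
    obtain n' where n': "n' > 0" "\<delta> (int n') x \<in> E" using ex[of x] insert by auto
    have "\<delta> (int (n * n')) f \<in> E" if "f \<in> insert x F'" for f
      using that insert.prems n n' delta_multiple[OF E, of f "int n" n'] delta_multiple[OF E, of x "int n'" n]
      by (auto simp: mult.commute)
    then show ?case using n n' by (intro exI[of _ "n * n'"]) auto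
  qed
  then obtain n where n: "n > 0" "\<forall>f\<in>F. \<delta> (int n) f \<in> E" using fin by blast
  have "\<delta> (int n) a \<in> E" if a: "a \<in> carrier A" for a
  proof -
    obtain f j where f: "f \<in> F" "congr E a (\<tau> j f)" using cover a by blast
    have fA: "f \<in> carrier A" using f fin by blast
    let ?e = "a \<otimes> inv (\<tau> j f)"
    have e: "?e \<in> E" "?e \<in> carrier A" using f a fA by (auto simp: congr_def)
    have "\<delta> (int n) ?e \<in> E"
      using e E by (simp add: \<delta>_def invariant_def subgroup.m_closed subgroup.m_inv_closed)
    moreover have "\<delta> (int n) (\<tau> j f) \<in> E" using f n fA by (simp add: delta_act_iff[OF E])
    moreover have "a = ?e \<otimes> \<tau> j f" using a fA by (simp add: m_assoc)
    ultimately show ?thesis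
      using delta_mult[of ?e "\<tau> j f" "int n"] e fA Es by (metis act_closed subgroup.m_closed)
  qed
  then show ?thesis using n by (auto simp: displacements_def)
qed

section \<open>Divisible groups covered by translates of cyclic groups\<close>

text \<open>Let \<open>D = (\<tau>\<^sup>n\<^sup>0 - 1)A\<close> and \<open>\<sigma> = \<tau>\<^sup>n\<^sup>0\<^sup>n\<close>. By stability both \<open>(\<sigma> - 1)A\<close> and \<open>(\<sigma>\<^sup>m - 1)A\<close> are equal to \<open>D\<close>, and \<open>\<sigma>\<close> acts
  trivially on \<open>D/mD\<close>. Writing \<open>\<sigma>\<^sup>m - 1\<close> as \<open>(1 + \<sigma> + \<dots> + \<sigma>\<^sup>m\<^sup>-\<^sup>1)(\<sigma> - 1)\<close>, an element \<open>(\<sigma>\<^sup>m - 1)a\<close> of \<open>D\<close> is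
  congruent to \<open>m(\<sigma> - 1)a\<close> modulo \<open>mD\<close>, and therefore it is in \<open>mD\<close>.\<close>
lemma powers_displacements:
  fixes m :: nat
  assumes n0: "n0 > 0" and stable: "\<And>k. k > 0 \<Longrightarrow> displacements (int (n0 * k)) = displacements (int n0)"
    and n: "n > 0" "displacements (int n) \<subseteq> powers m (carrier A)" and m: "m > 0"
  shows "displacements (int n0) = powers m (displacements (int n0))"
proof -
  let ?D = "displacements (int n0)" and ?q = "int (n0 * n)"
  let ?E = "powers m ?D"
  have D: "invariant ?D" and E: "invariant ?E"
    by (simp_all add: invariant_displacements invariant_powers)
  have Ds: "subgroup ?D A" and Es: "subgroup ?E A" using D E by (auto simp: invariant_def)
  have DA: "?D \<subseteq> carrier A" using Ds subgroup.subset by auto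
  have ED: "?E \<subseteq> ?D"
    using Ds by (auto simp: powers_def) (metis int_pow_int subgroup_int_pow_closed)
  have qD: "\<delta> ?q d \<in> ?E" if d: "d \<in> ?D" for d
  proof -
    obtain a where a: "a \<in> carrier A" "d = \<delta> (int n0) a" using d by (auto simp: displacements_def)
    have "\<delta> ?q a \<in> powers m (carrier A)"
      using n(2) displacements_mult[of "int n" n0] a(1)
      by (auto simp: displacements_def mult.commute)
    then obtain c where c: "c \<in> carrier A" "\<delta> ?q a = c [^] m" by (auto simp: powers_def)
    have "\<delta> ?q d = \<delta> (int n0) c [^] m"
      using a c by (simp only: delta_delta delta_nat_pow)
    then show ?thesis using c(1) by (auto simp: powers_def displacements_def)
  qed
  have "?D \<subseteq> ?E"
  proof
    fix d assume "d \<in> ?D"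
    then have "d \<in> displacements (int (n0 * (n * m)))" using stable[of "n * m"] n m by auto
    then obtain a where a: "a \<in> carrier A" "d = \<delta> (?q * int m) a"
      by (auto simp: displacements_def mult.assoc)
    let ?u = "\<delta> ?q a"
    have uD: "?u \<in> ?D" using stable[of n] n(1) a(1) by (auto simp: displacements_def)
    have uA: "?u \<in> carrier A" using a by simp
    have "\<exists>w\<in>?E. \<delta> (?q * int j) a = w \<otimes> ?u [^] j" for j
    proof (induction j)
      case 0
      have "\<delta> (?q * int 0) a = \<one> \<otimes> ?u [^] (0::nat)" using a by (simp add: \<delta>_def act_0)
      then show ?case using subgroup.one_closed[OF Es] by blast
    next
      case (Suc j)
      then obtain w where w: "w \<in> ?E" "\<delta> (?q * int j) a = w \<otimes> ?u [^] j" by blast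
      let ?v = "\<delta> (?q * int j) ?u"
      have v: "?v \<in> ?E" using delta_multiple[OF E uA qD[OF uD]] .
      have wA: "w \<in> carrier A" and vA: "?v \<in> carrier A" using w uA ED DA by auto
      have "\<delta> (?q * int (Suc j)) a = \<delta> (?q * int j + ?q) a" by (simp add: algebra_simps)
      also have "\<dots> = \<delta> (?q * int j) (?u \<otimes> a) \<otimes> ?u"
        using a by (simp only: delta_add act_eq_delta)
      also have "\<dots> = (?v \<otimes> (w \<otimes> ?u [^] j)) \<otimes> ?u"
        using a uA by (simp only: delta_mult w)
      also have "\<dots> = (?v \<otimes> w) \<otimes> ?u [^] Suc j"
        using uA wA vA by (simp add: m_assoc)
      finally show ?case using w v Es by (meson subgroup.m_closed)
    qed
    then obtain w where "w \<in> ?E" "d = w \<otimes> ?u [^] m" using a by blast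
    moreover have "?u [^] m \<in> ?E" using uD by (auto simp: powers_def)
    ultimately show "d \<in> ?E" using Es by (simp add: subgroup.m_closed)
  qed
  then show ?thesis using ED by blast
qed

text \<open>Suppose \<open>D \<noteq> 0\<close> and let \<open>p\<close> be a positive integer. An element \<open>c \<noteq> 0\<close> of \<open>Q\<close> is \<open>p\<close> times an element of
  \<open>D\<close>, hence a translate of a multiple of \<open>pc'\<close> for some \<open>c' \<in> Q\<close>. Iterating this inside the finite
  set \<open>Q\<close> leads to some \<open>c\<close> with \<open>c = \<tau>\<^sup>n(pJc)\<close>. So \<open>c\<close> is an eigenvector of a power of \<open>\<tau>\<close>, with an
  eigenvalue divisible by \<open>p\<close>. A single eigenvector \<open>x\<close> serves infinitely many primes. Let \<open>a\<close> be its
  eigenvalue for one of them and let \<open>p\<close> be another one that does not divide \<open>a\<close>. On \<open>x\<close> some power of \<open>\<tau>\<close>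
  acts both as a power of \<open>a\<close> and as a multiple of \<open>p\<close>, or as the inverse of such a multiple. As \<open>D\<close> is
  torsion-free, \<open>p\<close> divides a power of \<open>a\<close> or divides \<open>1\<close>.\<close>
lemma divisible_lines_trivial:
  assumes D: "invariant D"
    and torsion_free: "\<And>x k. \<lbrakk>x \<in> D; k \<noteq> (0::int); x [^] k = \<one>\<rbrakk> \<Longrightarrow> x = \<one>"
    and divisible: "\<And>m. m > 0 \<Longrightarrow> D = powers m D"
    and Q: "finite Q" "Q \<subseteq> D"
    and lines: "\<forall>d\<in>D. \<exists>c\<in>Q. \<exists>n k. d = \<tau> n (c [^] (k::int))"
  shows "D = {\<one>}"
proof (rule ccontr)
  assume "D \<noteq> {\<one>}"
  have Ds: "subgroup D A" using D by (simp add: invariant_def)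
  have DA: "D \<subseteq> carrier A" using Ds subgroup.subset by auto
  have inj: "a = b" if "x \<in> D" "x \<noteq> \<one>" "x [^] a = x [^] b" for x and a b :: int
  proof -
    have xA: "x \<in> carrier A" using that DA by auto
    have "x [^] (a - b) = \<one>" using xA that(3) by (simp add: int_pow_diff)
    then show ?thesis using torsion_free[of x "a - b"] that by auto
  qed
  let ?Q = "Q - {\<one>}"
  have self: "\<exists>c\<in>?Q. \<exists>n k. c = \<tau> n (c [^] (int p * k))" if p: "p > 0" for p
  proof -
    define R where "R c c' \<longleftrightarrow> (\<exists>n k. c = \<tau> n (c' [^] (int p * k)))" for c c'
    have step: "\<exists>c'\<in>?Q. R c c'" if c: "c \<in> ?Q" for c
    proof -
      obtain a where a: "a \<in> D" "c = a [^] p"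
        using c Q divisible[OF p] by (auto simp: powers_def)
      obtain c' n k where c': "c' \<in> Q" "a = \<tau> n (c' [^] (k::int))" using lines a by blast
      have c'A: "c' \<in> carrier A" using c' Q DA by auto
      have "c = \<tau> n ((c' [^] k) [^] int p)"
        using a(2) c'(2) c'A by (simp add: act_nat_pow int_pow_int)
      also have "\<dots> = \<tau> n (c' [^] (int p * k))"
        using c'A by (simp add: int_pow_pow mult.commute)
      finally have "R c c'" by (auto simp: R_def)
      moreover have "c' \<noteq> \<one>"
        using c a c'(2) by auto
      ultimately show ?thesis using c' by blast
    qed
    have trans: "R x z" if xy: "R x y" and yz: "R y z" and z: "z \<in> ?Q" for x y z
    proof -
      obtain n k n' k' where e: "x = \<tau> n (y [^] (int p * k))" "y = \<tau> n' (z [^] (int p * k'))"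
        using xy yz unfolding R_def by blast
      have zA: "z \<in> carrier A" using z Q DA by auto
      have "x = \<tau> (n + n') ((z [^] (int p * k')) [^] (int p * k))"
        using zA unfolding e by (simp add: act_add act_int_pow)
      also have "\<dots> = \<tau> (n + n') (z [^] (int p * (k' * int p * k)))"
        using zA by (simp add: int_pow_pow mult_ac)
      finally show ?thesis unfolding R_def by blast
    qed
    have "?Q \<noteq> {}"
    proof -
      obtain d where d: "d \<in> D" "d \<noteq> \<one>" using \<open>D \<noteq> {\<one>}\<close> subgroup.one_closed[OF Ds] by blast
      obtain c n k where "c \<in> Q" "d = \<tau> n (c [^] (k::int))" using lines d by blast
      then show ?thesis using d by auto
    qed
    then obtain c0 where c0: "c0 \<in> ?Q" by blast
    have "\<exists>h. \<forall>c\<in>?Q. h c \<in> ?Q \<and> R c (h c)" using step by metis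
    then obtain h where h: "\<And>c. c \<in> ?Q \<Longrightarrow> h c \<in> ?Q" "\<And>c. c \<in> ?Q \<Longrightarrow> R c (h c)" by blast
    \<comment> \<open>An infinite \<open>R\<close>-sequence in a finite set revisits a point, and \<open>R\<close> is transitive.\<close>
    define s where "s i = (h ^^ i) c0" for i
    have sQ: "s i \<in> ?Q" for i
    proof (induction i)
      case 0 then show ?case using c0 by (simp add: s_def)
    next
      case (Suc i) then show ?case using h(1)[OF Suc] by (simp add: s_def)
    qed
    have sR: "R (s i) (s (Suc (i + j)))" for i j
    proof (induction j)
      case 0 then show ?case using h(2)[OF sQ[of i]] by (simp add: s_def)
    next
      case (Suc j)
      have "R (s (Suc (i + j))) (s (Suc (i + Suc j)))" using h(2)[OF sQ[of "Suc (i + j)"]] by (simp add: s_def)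
      then show ?case using trans[OF Suc _ sQ] by blast
    qed
    obtain i i' where i: "i < i'" "s i = s i'"
      using nat_pigeonhole[of ?Q s] Q(1) sQ by (metis finite_Diff)
    then have "R (s i) (s i)" using sR[of i "i' - Suc i"] by simp
    then show ?thesis using sQ[of i] unfolding R_def by blast
  qed
  have "\<forall>p. \<exists>c. p > 0 \<longrightarrow> c \<in> ?Q \<and> (\<exists>n k. c = \<tau> n (c [^] (int p * k)))"
    using self by blast
  then obtain c where c: "\<And>p. p > 0 \<Longrightarrow> c p \<in> ?Q"
    and ck: "\<And>p. p > 0 \<Longrightarrow> \<exists>n k. c p = \<tau> n (c p [^] (int p * k))" by metis
  have "\<exists>x\<in>?Q. infinite {p \<in> {p. Factorial_Ring.prime p}. c p = x}"
    by (rule pigeonhole_infinite_rel[of "{p::nat. Factorial_Ring.prime p}" ?Q "\<lambda>p x. c p = x"])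
      (use primes_infinite Q(1) c prime_gt_0_nat in \<open>auto simp: prime_gt_0_nat\<close>)
  then obtain x where x: "x \<in> ?Q" "infinite {p. Factorial_Ring.prime p \<and> c p = x}" by auto
  have xD: "x \<in> D" "x \<noteq> \<one>" and xA: "x \<in> carrier A" using x Q DA by auto
  have mult: "\<tau> (- n * int j) x = x [^] (a ^ j)"
    if e: "x = \<tau> n (x [^] a)" for n j and a :: int
  proof -
    have base: "\<tau> (- n) x = x [^] a" by (subst (1) e) (use xA in simp)
    show ?thesis
    proof (induction j)
      case 0 then show ?case using xA by (simp add: act_0)
    next
      case (Suc j)
      have "\<tau> (- n * int (Suc j)) x = \<tau> (- n) (\<tau> (- n * int j) x)"
        using act_add[OF xA, of "- n" "- n * int j"] by (simp add: algebra_simps)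
      also have "\<dots> = x [^] (a * a ^ j)" unfolding Suc using xA base by (simp add: act_int_pow int_pow_pow)
      finally show ?case by simp
    qed
  qed
  obtain p0 where p0: "Factorial_Ring.prime p0" "c p0 = x"
    using x(2) not_finite_existsD by blast
  obtain n a where na: "x = \<tau> n (x [^] a)" "int p0 dvd a"
    using ck[of p0] p0 prime_gt_0_nat by (metis dvd_triv_left)
  have a0: "a \<noteq> 0" using na(1) xD(2) by auto
  have "finite {p::nat. int p dvd a}"
    using finite_vimageI[OF finite_divisors_int[OF a0], of int] by (simp add: vimage_def inj_on_def)
  then obtain p where p: "Factorial_Ring.prime p" "c p = x" "\<not> int p dvd a"
    using x(2) by (metis (mono_tags, lifting) finite_subset mem_Collect_eq subsetI)
  obtain n' b where nb: "x = \<tau> n' (x [^] b)" "int p dvd b"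
    using ck[of p] p prime_gt_0_nat by (metis dvd_triv_left)
  have notdvd: "\<not> int p dvd a ^ j" for j using p prime_dvd_power by (metis prime_nat_int_transfer)
  have unit: "\<not> int p dvd 1" using p(1) not_prime_unit prime_nat_int_transfer by blast
  have n0: "n \<noteq> 0"
  proof
    assume "n = 0"
    then have "a = 1" using inj[OF xD, of a 1] na(1) xA by (simp add: act_0)
    then show False using na(2) p0(1) not_prime_unit prime_nat_int_transfer by blast
  qed
  have n'0: "n' \<noteq> 0"
  proof
    assume "n' = 0"
    then have "b = 1" using inj[OF xD, of b 1] nb(1) xA by (simp add: act_0)
    then show False using nb(2) unit by blast
  qed
  \<comment> \<open>The exponents \<open>n i\<close> and \<open>n' j\<close> agree up to sign.\<close>
  define i j where "i = nat \<bar>n'\<bar>" and "j = nat \<bar>n\<bar>"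
  have pb: "int p dvd b ^ j" using nb(2) n0 by (simp add: j_def dvd_power_le dvd_power[THEN dvd_trans] dvd_trans)
  have A: "\<tau> (- n * int i) x = x [^] (a ^ i)" and B: "\<tau> (- n' * int j) x = x [^] (b ^ j)"
    using mult na nb by blast+
  show False
  proof (cases "sgn n = sgn n'")
    case True
    then have "n * int i = n' * int j" by (auto simp: i_def j_def sgn_if abs_if split: if_splits)
    then have "a ^ i = b ^ j" using inj[OF xD] A B by simp
    then show False using notdvd pb by metis
  next
    case False
    then have opp: "n * int i = - (n' * int j)" using n0 n'0
      by (auto simp: i_def j_def sgn_if abs_if split: if_splits)
    have "x = \<tau> (- n * int i) (\<tau> (- n' * int j) x)"
      using xA opp by (simp flip: act_add add: act_0)
    also have "\<dots> = x [^] (a ^ i * b ^ j)" using A B xA by (simp add: act_int_pow int_pow_pow)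
    finally have "a ^ i * b ^ j = 1" using inj[OF xD, of "a ^ i * b ^ j" 1] xA by simp
    then show False using pb unit by (metis dvd_mult)
  qed
qed

text \<open>The hypotheses \<open>root\<close> and \<open>cover\<close> express that \<open>A\<close> is covered by the translates of finitely many
  virtually cyclic subgroups, each given by cosets \<open>f\<langle>b\<rangle>\<close>. The subgroup \<open>D\<close> at which the displacements
  stabilise is divisible and torsion-free, and \<open>D = eD\<close> makes it a union of translates of the cyclic
  groups \<open>D \<inter> \<langle>b\<rangle>\<close>. So it is trivial, and then all orbits are finite.\<close>
theorem finite_if_cyclic_cover_and_few_orbits:
  fixes N :: nat
  assumes few_orbits: "\<And>n. n > 0 \<Longrightarrow> \<exists>R. finite R \<and> card R \<le> N \<and> R \<subseteq> carrier A \<and>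
      (\<forall>a\<in>carrier A. \<exists>r\<in>R. \<exists>j. \<exists>d\<in>displacements (int n). a = \<tau> j r \<otimes> d)"
    and P: "finite P" "P \<subseteq> carrier A \<times> carrier A"
    and root: "\<And>f b. (f, b) \<in> P \<Longrightarrow> \<exists>e>(0::nat). \<exists>i::int. f [^] e = b [^] i"
    and cover: "\<forall>a\<in>carrier A. \<exists>(f, b)\<in>P. \<exists>n. \<exists>k::int. a = \<tau> n (f \<otimes> b [^] k)"
  shows "finite (carrier A)"
proof -
  obtain n0 where n0: "n0 > 0" and stable: "\<And>m. m > 0 \<Longrightarrow> displacements (int (n0 * m)) = displacements (int n0)"
    using displacements_stabilise[OF few_orbits] by blast
  let ?D = "displacements (int n0)"
  have D: "invariant ?D" by (rule invariant_displacements)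
  have Ds: "subgroup ?D A" using D by (simp add: invariant_def)
  have DA: "?D \<subseteq> carrier A" using Ds subgroup.subset by auto
  have PA: "f \<in> carrier A" "b \<in> carrier A" if "(f, b) \<in> P" for f b using that P by auto

  have divisible: "?D = powers m ?D" if m: "m > 0" for m
  proof -
    let ?E = "powers m (carrier A)"
    have E: "invariant ?E" by (simp add: invariant_powers invariant_carrier)
    have Es: "subgroup ?E A" using E by (simp add: invariant_def)
    let ?F = "(\<lambda>((f, b), j). f \<otimes> b [^] (j::int)) ` (P \<times> {0..<int m})"
    have F: "finite ?F" "?F \<subseteq> carrier A" using P by auto
    have "\<forall>a\<in>carrier A. \<exists>f\<in>?F. \<exists>n. congr ?E a (\<tau> n f)"
    proof
      fix a assume a: "a \<in> carrier A"
      obtain f b n k where fb: "(f, b) \<in> P" "a = \<tau> n (f \<otimes> b [^] (k::int))" using cover a by blast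
      note fbA = PA[OF fb(1)]
      have "b [^] k = b [^] (k mod int m + (k div int m) * int m)" by simp
      also have "\<dots> = b [^] (k mod int m) \<otimes> (b [^] (k div int m)) [^] m"
        using fbA(2) by (simp only: int_pow_mult nat_pow_int_pow)
      finally have "f \<otimes> b [^] k = (f \<otimes> b [^] (k mod int m)) \<otimes> (b [^] (k div int m)) [^] m"
        using fbA by (simp add: m_assoc)
      then have "a = \<tau> n (f \<otimes> b [^] (k mod int m)) \<otimes> (\<tau> n (b [^] (k div int m))) [^] m"
        using fb(2) fbA by (simp add: act_mult act_nat_pow)
      then have "a \<otimes> inv (\<tau> n (f \<otimes> b [^] (k mod int m))) = (\<tau> n (b [^] (k div int m))) [^] m"
        using fbA by (simp add: m_ac)
      then have "congr ?E a (\<tau> n (f \<otimes> b [^] (k mod int m)))"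
        using fbA a unfolding congr_def powers_def by blast
      moreover have "f \<otimes> b [^] (k mod int m) \<in> ?F"
        using fb(1) m by (intro image_eqI[of _ _ "((f, b), k mod int m)"]) auto
      ultimately show "\<exists>f\<in>?F. \<exists>n. congr ?E a (\<tau> n f)" by blast
    qed
    then obtain n where "n > 0" "displacements (int n) \<subseteq> ?E"
      using displacements_subset_of_finite_orbits[OF E m subset_refl F] by blast
    then show ?thesis using powers_displacements[OF n0 stable] m by blast
  qed

  obtain e where e: "e > (0::nat)"
    and root_e: "\<forall>(f, b)\<in>P. \<forall>k::int. \<exists>j::int. (f \<otimes> b [^] k) [^] e = b [^] j"
    using uniform_root[OF P] root by blast
  let ?B = "snd ` P"
  have B: "finite ?B" "?B \<subseteq> carrier A" using P by auto
  have line: "\<exists>b\<in>?B. \<exists>n. \<exists>k::int. a [^] e = \<tau> n (b [^] k)" if a: "a \<in> carrier A" for a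
  proof -
    obtain f b n k where fb: "(f, b) \<in> P" "a = \<tau> n (f \<otimes> b [^] (k::int))" using cover a by blast
    note fbA = PA[OF fb(1)]
    obtain j :: int where "(f \<otimes> b [^] k) [^] e = b [^] j" using root_e fb(1) by blast
    then have "a [^] e = \<tau> n (b [^] j)" using fb(2) fbA by (simp flip: act_nat_pow)
    then show ?thesis using fb(1) by force
  qed

  \<comment> \<open>The torsion elements of \<open>A\<close> have bounded exponent: the \<open>e\<close>-th power of such an element is a
    translate of \<open>b\<^sup>j\<close>, where \<open>j = 0\<close> unless \<open>b\<close> is itself a torsion element.\<close>
  obtain t where t: "t > (0::nat)" and tors: "\<And>b k. \<lbrakk>b \<in> ?B; k \<noteq> (0::int); b [^] k = \<one>\<rbrakk> \<Longrightarrow> b [^] t = \<one>"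
  proof -
    have "\<exists>t>(0::nat). \<forall>b\<in>?B. b \<in> ?B \<and> ((\<exists>k\<noteq>(0::int). b [^] k = \<one>) \<longrightarrow> b [^] t = \<one>)"
    proof (rule finite_common_multiple[OF B(1)])
      fix b assume b: "b \<in> ?B"
      show "\<exists>t>(0::nat). b \<in> ?B \<and> ((\<exists>k\<noteq>(0::int). b [^] k = \<one>) \<longrightarrow> b [^] t = \<one>)"
      proof (cases "\<exists>k\<noteq>(0::int). b [^] k = \<one>")
        case True
        then obtain k where k: "k \<noteq> (0::int)" "b [^] k = \<one>" by blast
        have bA: "b \<in> carrier A" using b B by auto
        have "b [^] nat \<bar>k\<bar> = \<one>"
          using k bA by (auto simp: abs_if int_pow_neg simp flip: int_pow_int)
        then show ?thesis using k b by (intro exI[of _ "nat \<bar>k\<bar>"]) auto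
      next
        case False then show ?thesis using b by (intro exI[of _ 1]) blast
      qed
    next
      fix b and t k :: nat
      assume "b \<in> ?B \<and> ((\<exists>k\<noteq>(0::int). b [^] k = \<one>) \<longrightarrow> b [^] t = \<one>)"
      moreover have "b [^] (t * k) = \<one>" if "b \<in> ?B" "b [^] t = \<one>"
        using that B by (auto simp flip: nat_pow_pow)
      ultimately show "b \<in> ?B \<and> ((\<exists>k\<noteq>(0::int). b [^] k = \<one>) \<longrightarrow> b [^] (t * k) = \<one>)" by blast
    qed
    then show ?thesis using that by blast
  qed
  have torsion_exponent: "x [^] (e * t) = \<one>" if x: "x \<in> carrier A" "k \<noteq> (0::int)" "x [^] k = \<one>" for x k
  proof -
    obtain b n j where b: "b \<in> ?B" "x [^] e = \<tau> n (b [^] (j::int))" using line[OF x(1)] by blast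
    have bA: "b \<in> carrier A" using b B by auto
    have "(x [^] e) [^] k = (x [^] k) [^] e"
      using x(1) by (simp add: int_pow_pow mult.commute flip: int_pow_int)
    then have "\<tau> n ((b [^] j) [^] k) = \<one>"
      using x(3) bA by (simp add: b(2) act_int_pow)
    then have "(b [^] j) [^] k = \<one>"
      using act_inj[of "(b [^] j) [^] k" \<one> n] bA by simp
    then have bjk: "b [^] (j * k) = \<one>" using bA by (simp add: int_pow_pow)
    have "(b [^] j) [^] t = \<one>"
    proof (cases "j = 0")
      case False
      then have "b [^] t = \<one>" using tors[OF b(1) _ bjk] x(2) by simp
      moreover have "(b [^] j) [^] t = (b [^] t) [^] j"
        using bA by (simp add: int_pow_pow mult.commute flip: int_pow_int)
      ultimately show ?thesis by simp
    qed simp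
    then have "\<tau> n ((b [^] j) [^] t) = \<one>" by simp
    then show ?thesis using bA x(1) by (simp add: b(2) act_nat_pow flip: nat_pow_pow)
  qed
  have torsion_free: "x = \<one>" if x: "x \<in> ?D" "k \<noteq> (0::int)" "x [^] k = \<one>" for x k
  proof -
    obtain y where y: "y \<in> ?D" "x = y [^] (e * t)"
      using x(1) divisible[of "e * t"] e t by (auto simp: powers_def)
    have yA: "y \<in> carrier A" using y DA by auto
    have "y [^] (int (e * t) * k) = \<one>"
      using x(3) y(2) yA by (metis int_pow_int int_pow_pow)
    then show ?thesis using torsion_exponent[OF yA _ \<open>y [^] (int (e * t) * k) = \<one>\<close>] x(2) e t y(2) by simp
  qed

  \<comment> \<open>The group \<open>D \<inter> \<langle>b\<rangle>\<close> is generated by \<open>b\<close> to the power \<open>g b\<close>.\<close>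
  have "\<forall>b\<in>?B. \<exists>g::int. b [^] g \<in> ?D \<and> (\<forall>k::int. b [^] k \<in> ?D \<longrightarrow> g dvd k)"
    using powers_in_subgroup_generator[OF Ds] B by (metis subsetD)
  then obtain g where g: "\<And>b. b \<in> ?B \<Longrightarrow> b [^] (g b :: int) \<in> ?D"
    and gdvd: "\<And>b k. \<lbrakk>b \<in> ?B; b [^] (k::int) \<in> ?D\<rbrakk> \<Longrightarrow> g b dvd k" by metis
  let ?Q = "(\<lambda>b. b [^] g b) ` ?B"
  have Q: "\<forall>d\<in>?D. \<exists>c\<in>?Q. \<exists>n k. d = \<tau> n (c [^] (k::int))"
  proof
    fix d assume d: "d \<in> ?D"
    then obtain y where y: "y \<in> ?D" "d = y [^] e" using divisible[OF e] by (auto simp: powers_def)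
    have yA: "y \<in> carrier A" and dA: "d \<in> carrier A" using y d DA by auto
    obtain b n k where b: "b \<in> ?B" "d = \<tau> n (b [^] (k::int))" using line[OF yA] y(2) by blast
    have bA: "b \<in> carrier A" using b B by auto
    have "b [^] k = \<tau> (- n) d" using b(2) bA by simp
    then have "b [^] k \<in> ?D" using D d by (simp add: invariant_def)
    then obtain k' where "k = g b * k'" using gdvd[OF b(1)] by blast
    then have "d = \<tau> n ((b [^] g b) [^] k')" using b(2) bA by (simp add: int_pow_pow)
    then show "\<exists>c\<in>?Q. \<exists>n k. d = \<tau> n (c [^] (k::int))" using b(1) by blast
  qed
  have D1: "?D = {\<one>}"
  proof (rule divisible_lines_trivial[OF D])
    show "finite ?Q" "?Q \<subseteq> ?D" using B g by blast+
    show "x = \<one>" if "x \<in> ?D" "k \<noteq> (0::int)" "x [^] k = \<one>" for x k by (rule torsion_free[OF that])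
    show "?D = powers m ?D" if "m > 0" for m by (rule divisible[OF that])
  qed (rule Q)

  have period: "\<tau> (int n0 * k) x = x" if x: "x \<in> carrier A" for x k
  proof -
    have fix1: "\<tau> (int n0) y = y" if "y \<in> carrier A" for y
      using that D1 act_eq_delta[OF that, of "int n0"] by (auto simp: displacements_def)
    have nat: "\<tau> (int n0 * int j) y = y" if y: "y \<in> carrier A" for j y
    proof (induction j)
      case 0 then show ?case using y by (simp add: act_0)
    next
      case (Suc j)
      have "\<tau> (int n0 * int (Suc j)) y = \<tau> (int n0) (\<tau> (int n0 * int j) y)"
        using act_add[OF y, of "int n0" "int n0 * int j"] by (simp add: algebra_simps)
      then show ?case using Suc fix1 y by simp
    qed
    show ?thesis
    proof (cases "k \<ge> 0")
      case True then show ?thesis using nat[OF x, of "nat k"] by simp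
    next
      case False
      then have "\<tau> (- (int n0 * k)) x = x" using nat[OF x, of "nat (- k)"] by simp
      then show ?thesis using act_neg_cancel(2)[OF x, of "int n0 * k"] by simp
    qed
  qed
  obtain R where R: "finite R" "R \<subseteq> carrier A"
    "\<forall>a\<in>carrier A. \<exists>r\<in>R. \<exists>j. \<exists>d\<in>?D. a = \<tau> j r \<otimes> d"
    using few_orbits[OF n0] by blast
  have "carrier A \<subseteq> (\<lambda>(j, r). \<tau> j r) ` ({0..<int n0} \<times> R)"
  proof
    fix a assume "a \<in> carrier A"
    then obtain r j d where r: "r \<in> R" "a = \<tau> j r \<otimes> d" "d \<in> ?D" using R(3) by blast
    then have "d = \<one>" using D1 by blast
    have rA: "r \<in> carrier A" using r R by auto
    have "\<tau> j r = \<tau> (j mod int n0) (\<tau> (int n0 * (j div int n0)) r)"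
      using act_add[OF rA, of "j mod int n0" "int n0 * (j div int n0)"] by simp
    then have "a = \<tau> (j mod int n0) r" using r rA period[OF rA] \<open>d = \<one>\<close> by simp
    then show "a \<in> (\<lambda>(j, r). \<tau> j r) ` ({0..<int n0} \<times> R)"
      using r(1) n0 by (intro image_eqI[of _ _ "(j mod int n0, r)"]) auto
  qed
  then show ?thesis using R(1) finite_subset by blast
qed

end

section \<open>Virtually cyclic subgroups\<close>

text \<open>Virtual cyclicity of a subgroup in terms of its elements: representatives of the cosets of a
  cyclic subgroup replace the set of cosets, which makes images and intersections easy to handle.\<close>
definition cyclic_by_finite :: "('a, 'b) monoid_scheme \<Rightarrow> 'a set \<Rightarrow> bool" where
  "cyclic_by_finite G V \<longleftrightarrow> (\<exists>c\<in>V. \<exists>F\<subseteq>V. finite F \<and>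
     (\<forall>v\<in>V. \<exists>k::int. \<exists>f\<in>F. v = c [^]\<^bsub>G\<^esub> k \<otimes>\<^bsub>G\<^esub> f))"

lemma (in group) virtually_cyclic_imp_cyclic_by_finite:
  assumes V: "subgroup V G" and vc: "virtually_cyclic (G\<lparr>carrier := V\<rparr>)"
  shows "cyclic_by_finite G V"
proof -
  let ?V = "G\<lparr>carrier := V\<rparr>"
  interpret V: group ?V using V subgroup.subgroup_is_group is_group by blast
  obtain C where C: "subgroup C ?V" "cyclic_group (?V\<lparr>carrier := C\<rparr>)" "finite (rcosets\<^bsub>?V\<^esub> C)"
    using vc unfolding virtually_cyclic_def by blast
  have CV: "C \<subseteq> V" using subgroup.subset[OF C(1)] by simp
  have CG: "subgroup C G" using C(1) V incl_subgroup by blast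
  interpret C: group "G\<lparr>carrier := C\<rparr>" using CG subgroup.subgroup_is_group is_group by blast
  have "cyclic_group (G\<lparr>carrier := C\<rparr>)" using C(2) by simp
  then obtain c where c: "c \<in> C" "C = range (\<lambda>n::int. c [^]\<^bsub>G\<lparr>carrier := C\<rparr>\<^esub> n)"
    using C.cyclic_group by auto
  then have Cp: "\<exists>n::int. x = c [^] n" if "x \<in> C" for x
    using that int_pow_consistent[OF CG c(1)] by auto
  let ?r = "\<lambda>K. SOME x. x \<in> K"
  let ?F = "?r ` (rcosets\<^bsub>?V\<^esub> C)"
  have r: "?r K \<in> K" if "K \<in> rcosets\<^bsub>?V\<^esub> C" for K
    using V.subgroup_self subgroup.rcosets_non_empty[OF C(1) that] some_in_eq by blast
  have "?F \<subseteq> V"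
  proof
    fix x assume "x \<in> ?F"
    then obtain K where "K \<in> rcosets\<^bsub>?V\<^esub> C" "x = ?r K" by blast
    then show "x \<in> V" using r V.rcosets_part_G[OF C(1)] by fastforce
  qed
  moreover have "\<exists>k::int. \<exists>f\<in>?F. v = c [^] k \<otimes> f" if v: "v \<in> V" for v
  proof -
    let ?K = "C #>\<^bsub>?V\<^esub> v"
    have K: "?K \<in> rcosets\<^bsub>?V\<^esub> C" using v CV by (intro V.rcosetsI) auto
    then have "?r ?K \<in> ?K" by (rule r)
    then obtain x where x: "x \<in> C" "?r ?K = x \<otimes> v" by (auto simp: r_coset_def)
    obtain n :: int where n: "x = c [^] n" using Cp[OF x(1)] by blast
    have cG: "c \<in> carrier G" and vG: "v \<in> carrier G"
      using subgroup.mem_carrier[OF CG c(1)] subgroup.mem_carrier[OF V v] .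
    have "v = c [^] (- n) \<otimes> ?r ?K"
      using cG vG unfolding x(2) n by (simp add: int_pow_neg flip: m_assoc)
    then show ?thesis using K by blast
  qed
  moreover have "finite ?F" using C(3) by simp
  moreover have "c \<in> V" using c(1) CV by blast
  ultimately show ?thesis unfolding cyclic_by_finite_def by blast
qed

lemma (in group) cyclic_by_finite_imp_virtually_cyclic:
  assumes "cyclic_by_finite G (carrier G)"
  shows "virtually_cyclic G"
proof -
  obtain c F where c: "c \<in> carrier G" and F: "F \<subseteq> carrier G" "finite F"
    and cF: "\<And>v. v \<in> carrier G \<Longrightarrow> \<exists>k::int. \<exists>f\<in>F. v = c [^] k \<otimes> f"
    using assms unfolding cyclic_by_finite_def by blast
  let ?C = "generate G {c}"
  have C: "subgroup ?C G" using c generate_is_subgroup by simp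
  have Cpow: "?C = range (\<lambda>k::int. c [^] k)" using generate_pow[OF c] by auto
  interpret C: group "G\<lparr>carrier := ?C\<rparr>" using C subgroup.subgroup_is_group is_group by blast
  have cC: "c \<in> ?C" by (simp add: generate.incl)
  have "carrier (G\<lparr>carrier := ?C\<rparr>) = range (\<lambda>k::int. c [^]\<^bsub>G\<lparr>carrier := ?C\<rparr>\<^esub> k)"
    using Cpow int_pow_consistent[OF C cC] by simp
  then have "cyclic_group (G\<lparr>carrier := ?C\<rparr>)" using cC C.cyclic_group by auto
  moreover have "rcosets ?C \<subseteq> (\<lambda>f. ?C #> f) ` F"
  proof
    fix K assume "K \<in> rcosets ?C"
    then obtain v where v: "v \<in> carrier G" "K = ?C #> v" by (auto simp: RCOSETS_def)
    then obtain k :: int and f where f: "f \<in> F" "v = c [^] k \<otimes> f" using cF by blast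
    have "v \<in> ?C #> f" using f(2) Cpow by (auto simp: r_coset_def)
    then have "K = ?C #> f" using repr_independence[OF _ _ C] f F v by blast
    then show "K \<in> (\<lambda>f. ?C #> f) ` F" using f by blast
  qed
  then have "finite (rcosets ?C)" using F finite_subset by blast
  ultimately show ?thesis using C unfolding virtually_cyclic_def by blast
qed

lemma (in group_hom) cyclic_by_finite_image:
  assumes V: "V \<subseteq> carrier G" and cbf: "cyclic_by_finite G V"
  shows "cyclic_by_finite H (h ` V)"
proof -
  obtain c F where c: "c \<in> V" and F: "F \<subseteq> V" "finite F"
    and cF: "\<And>v. v \<in> V \<Longrightarrow> \<exists>k::int. \<exists>f\<in>F. v = c [^] k \<otimes> f"
    using cbf unfolding cyclic_by_finite_def by blast
  have "\<exists>k::int. \<exists>f\<in>h ` F. h v = h c [^]\<^bsub>H\<^esub> k \<otimes>\<^bsub>H\<^esub> f" if v: "v \<in> V" for v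
  proof -
    obtain k :: int and f where f: "f \<in> F" "v = c [^] k \<otimes> f" using cF[OF v] by blast
    then have "h v = h c [^]\<^bsub>H\<^esub> k \<otimes>\<^bsub>H\<^esub> h f" using c F V by (auto simp: hom_int_pow subset_iff)
    then show ?thesis using f by blast
  qed
  moreover have "h ` F \<subseteq> h ` V" using F by blast
  ultimately show ?thesis using c F unfolding cyclic_by_finite_def by blast
qed

text \<open>The intersection of \<open>W\<close> with \<open>\<langle>c\<rangle>\<close> is cyclic, and each coset \<open>\<langle>c\<rangle>f\<close> that meets \<open>W\<close> meets it in a
  single coset of that intersection.\<close>
lemma (in group) cyclic_by_finite_subgroup:
  assumes V: "V \<subseteq> carrier G" "cyclic_by_finite G V" and W: "subgroup W G" "W \<subseteq> V"
  shows "cyclic_by_finite G W"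
proof -
  obtain c F where c: "c \<in> V" and F: "F \<subseteq> V" "finite F"
    and cF: "\<And>v. v \<in> V \<Longrightarrow> \<exists>k::int. \<exists>f\<in>F. v = c [^] k \<otimes> f"
    using V unfolding cyclic_by_finite_def by blast
  have cG: "c \<in> carrier G" using c V by blast
  obtain g :: int where g: "c [^] g \<in> W" "\<And>k::int. c [^] k \<in> W \<Longrightarrow> g dvd k"
    using powers_in_subgroup_generator[OF W(1) cG] by blast
  let ?meets = "\<lambda>f w. w \<in> W \<and> (\<exists>k::int. w = c [^] k \<otimes> f)"
  let ?F = "{f \<in> F. \<exists>w. ?meets f w}"
  let ?s = "\<lambda>f. SOME w. ?meets f w"
  have s: "?meets f (?s f)" if "f \<in> ?F" for f
    using someI_ex[of "?meets f"] that by blast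
  have "\<exists>k::int. \<exists>f\<in>?s ` ?F. w = (c [^] g) [^] k \<otimes> f" if w: "w \<in> W" for w
  proof -
    obtain k :: int and f where f: "f \<in> F" "w = c [^] k \<otimes> f" using cF w W by blast
    then have fF: "f \<in> ?F" using w by blast
    obtain l :: int where l: "?s f = c [^] l \<otimes> f" using s[OF fF] by blast
    have fG: "f \<in> carrier G" using f F V by blast
    have "w \<otimes> inv (?s f) \<in> W" using w s[OF fF] W(1) by (simp add: subgroup.m_closed subgroup.m_inv_closed)
    moreover have e: "w \<otimes> inv (?s f) = c [^] (k - l)"
      unfolding l f(2) using cG fG by (simp add: inv_mult_group m_assoc int_pow_diff) (simp flip: m_assoc)
    ultimately obtain m where m: "k - l = g * m" using g(2) by (metis dvd_def)
    have "w = (w \<otimes> inv (?s f)) \<otimes> ?s f"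
      using subgroup.mem_carrier[OF W(1)] w s[OF fF] by (simp add: m_assoc)
    also have "w \<otimes> inv (?s f) = (c [^] g) [^] m" using cG by (simp add: e m int_pow_pow)
    finally show ?thesis using fF by blast
  qed
  moreover have "?s ` ?F \<subseteq> W" using s by blast
  moreover have "finite (?s ` ?F)" using F by simp
  ultimately show ?thesis using g(1) unfolding cyclic_by_finite_def by blast
qed

text \<open>Two different powers of \<open>v\<close> lie in the same coset \<open>\<langle>c\<rangle>f\<close>.\<close>
lemma (in group) power_in_cyclic_part:
  assumes V: "subgroup V G" and c: "c \<in> V" and F: "finite F" "F \<subseteq> V"
    and cF: "\<And>v. v \<in> V \<Longrightarrow> \<exists>k::int. \<exists>f\<in>F. v = c [^] k \<otimes> f" and v: "v \<in> V"
  shows "\<exists>e>(0::nat). \<exists>i::int. v [^] e = c [^] i"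
proof -
  have VG: "V \<subseteq> carrier G" using V subgroup.subset by blast
  have vG: "v \<in> carrier G" and cG: "c \<in> carrier G" using v c VG by auto
  have "v [^] n \<in> V" for n :: nat
    using subgroup_int_pow_closed[OF V v, of "int n"] by (simp add: int_pow_int)
  then have "\<forall>n::nat. \<exists>f. f \<in> F \<and> (\<exists>k::int. v [^] n = c [^] k \<otimes> f)" using cF by blast
  then obtain f where f: "\<And>n. f n \<in> F" and fk: "\<And>n. \<exists>k::int. v [^] (n::nat) = c [^] k \<otimes> f n"
    by metis
  obtain n n' where n: "n < n'" "f n = f n'" using nat_pigeonhole[of F f] F(1) f by blast
  obtain k k' :: int where k: "v [^] n = c [^] k \<otimes> f n" "v [^] n' = c [^] k' \<otimes> f n"
    using fk n(2) by metis
  have fG: "f n \<in> carrier G" using f F VG by blast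
  have "v [^] (n' - n) = v [^] n' \<otimes> inv (v [^] n)"
    using vG n(1) nat_pow_mult[OF vG, of "n' - n" n]
    by (metis inv_solve_right less_imp_le_nat le_add_diff_inverse2 nat_pow_closed)
  also have "\<dots> = c [^] (k' - k)"
    unfolding k using cG fG by (simp add: inv_mult_group m_assoc int_pow_diff) (simp flip: m_assoc)
  finally show ?thesis using n(1) by (intro exI[of _ "n' - n"]) auto
qed

text \<open>An abelian group covered by finitely many virtually cyclic subgroups is virtually cyclic. The
  idea is that all elements \<open>b\<close> of infinite order are commensurable. Fix one of them, \<open>b\<^sub>0\<close>. For any
  \<open>a\<close>, the \<open>e\<close>-th powers of two of the elements \<open>b\<^sub>0, b\<^sub>0a, b\<^sub>0a\<^sup>2, \<dots>\<close> lie in the same cyclic group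
  \<open>\<langle>b\<rangle>\<close>. Eliminating \<open>b\<^sub>0\<close> and \<open>a\<close> in turn, nontrivial powers of \<open>a\<close> and of \<open>b\<^sub>0\<close> lie in \<open>\<langle>b\<rangle>\<close>, and so a
  power of \<open>a\<close> lies in \<open>\<langle>b\<^sub>0\<rangle>\<close>. Hence every coset \<open>f\<langle>b\<rangle>\<close> is contained in finitely many cosets of
  \<open>\<langle>b\<^sub>0\<rangle>\<close>.\<close>
lemma (in comm_group) cyclic_by_finite_if_covered:
  assumes P: "finite P" "P \<subseteq> carrier G \<times> carrier G"
    and root: "\<And>f b. (f, b) \<in> P \<Longrightarrow> \<exists>e>(0::nat). \<exists>i::int. f [^] e = b [^] i"
    and cover: "\<forall>a\<in>carrier G. \<exists>(f, b)\<in>P. \<exists>k::int. a = f \<otimes> b [^] k"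
  shows "cyclic_by_finite G (carrier G)"
proof -
  obtain e where e: "e > (0::nat)"
    and root_e: "\<forall>(f, b)\<in>P. \<forall>k::int. \<exists>j::int. (f \<otimes> b [^] k) [^] e = b [^] j"
    using uniform_root[OF P] root by blast
  let ?B = "snd ` P"
  have B: "finite ?B" "?B \<subseteq> carrier G" using P by auto
  have line: "\<exists>b\<in>?B. \<exists>j::int. a [^] e = b [^] j" if a: "a \<in> carrier G" for a
    using cover[rule_format, OF a] root_e by force
  have "\<exists>b0\<in>carrier G. \<forall>a\<in>?B. \<exists>M>(0::nat). \<exists>L::int. a [^] M = b0 [^] L"
  proof (cases "\<exists>b0\<in>?B. \<forall>k::int. b0 [^] k = \<one> \<longrightarrow> k = 0")
    case False
    \<comment> \<open>All \<open>b\<close> are torsion elements, and \<open>b\<^sub>0 = \<one>\<close> does.\<close>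
    have "\<exists>M>(0::nat). \<exists>L::int. a [^] M = \<one> [^] L" if a: "a \<in> ?B" for a
    proof -
      have aG: "a \<in> carrier G" using a B by auto
      obtain k :: int where k: "k \<noteq> 0" "a [^] k = \<one>" using False a by blast
      then have "a [^] nat \<bar>k\<bar> = \<one>" using aG by (auto simp: abs_if int_pow_neg simp flip: int_pow_int)
      then show ?thesis using k by (intro exI[of _ "nat \<bar>k\<bar>"]) auto
    qed
    then show ?thesis by blast
  next
    case True
    then obtain b0 where b0: "b0 \<in> ?B" and inf: "\<And>k::int. b0 [^] k = \<one> \<Longrightarrow> k = 0" by blast
    have b0G: "b0 \<in> carrier G" using b0 B by auto
    have "\<exists>M>(0::nat). \<exists>L::int. a [^] M = b0 [^] L" if a: "a \<in> ?B" for a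
    proof -
      have aG: "a \<in> carrier G" using a B by auto
      have "\<forall>k::nat. \<exists>b. b \<in> ?B \<and> (\<exists>j::int. (b0 \<otimes> a [^] k) [^] e = b [^] j)"
        using line aG b0G by (meson m_closed nat_pow_closed)
      then obtain \<beta> where \<beta>: "\<And>k. \<beta> k \<in> ?B"
        and \<beta>j: "\<And>k. \<exists>j::int. (b0 \<otimes> a [^] (k::nat)) [^] e = \<beta> k [^] j" by metis
      obtain k k' where k: "k < k'" "\<beta> k = \<beta> k'" using nat_pigeonhole[of ?B \<beta>] B(1) \<beta> by blast
      let ?b = "\<beta> k"
      have bG: "?b \<in> carrier G" using \<beta> B by blast
      obtain j j' :: int where j: "(b0 \<otimes> a [^] k) [^] e = ?b [^] j" "(b0 \<otimes> a [^] k') [^] e = ?b [^] j'"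
        using \<beta>j k(2) by metis
      define d where "d = int k' - int k"
      have d: "d > 0" using k(1) by (simp add: d_def)
      have 1: "b0 [^] int e \<otimes> a [^] (int k * int e) = ?b [^] j"
        using j(1) aG b0G nat_pow_int_pow[of a "int k" e]
        by (simp add: pow_mult_distrib m_comm int_pow_int)
      have 2: "b0 [^] int e \<otimes> a [^] (int k' * int e) = ?b [^] j'"
        using j(2) aG b0G nat_pow_int_pow[of a "int k'" e]
        by (simp add: pow_mult_distrib m_comm int_pow_int)
      have ba: "?b [^] (j' - j) = a [^] (d * int e)"
      proof -
        have "?b [^] (j' - j) = (b0 [^] int e \<otimes> a [^] (int k' * int e)) \<otimes> inv (b0 [^] int e \<otimes> a [^] (int k * int e))"
          using bG by (simp add: int_pow_diff 1 2)
        also have "\<dots> = a [^] (int k' * int e) \<otimes> inv (a [^] (int k * int e))"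
          using aG b0G by (simp add: inv_mult_group m_ac) (simp flip: m_assoc)
        also have "\<dots> = a [^] (d * int e)" using aG by (simp add: d_def algebra_simps int_pow_diff)
        finally show ?thesis .
      qed
      have bb0: "?b [^] (j * int k' - j' * int k) = b0 [^] (int e * d)"
      proof -
        have "?b [^] (j * int k' - j' * int k) = (?b [^] j) [^] int k' \<otimes> inv ((?b [^] j') [^] int k)"
          using bG by (simp add: int_pow_diff int_pow_pow)
        also have "\<dots> = (b0 [^] (int e * int k') \<otimes> a [^] (int k * int e * int k')) \<otimes>
            inv (b0 [^] (int e * int k) \<otimes> a [^] (int k' * int e * int k))"
          using aG b0G by (simp add: int_pow_pow int_pow_distrib flip: 1 2)
        also have "\<dots> = b0 [^] (int e * int k') \<otimes> inv (b0 [^] (int e * int k))"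
          using quotient_cancel[of "b0 [^] (int e * int k')" "b0 [^] (int e * int k)" "a [^] (int k * int e * int k')"]
            aG b0G by (simp add: mult_ac)
        also have "\<dots> = b0 [^] (int e * d)" using b0G by (simp add: d_def algebra_simps int_pow_diff)
        finally show ?thesis .
      qed
      define i where "i = j * int k' - j' * int k"
      have i0: "i \<noteq> 0"
      proof
        assume "i = 0"
        then have "b0 [^] (int e * d) = \<one>" using bb0 by (simp add: i_def)
        then show False using inf d e by fastforce
      qed
      have "a [^] (d * int e * i) = (?b [^] (j' - j)) [^] i" using aG by (simp add: ba int_pow_pow)
      also have "\<dots> = (?b [^] i) [^] (j' - j)" using bG by (simp add: int_pow_pow mult.commute)
      also have "\<dots> = b0 [^] (int e * d * (j' - j))" using b0G bb0 by (simp add: i_def int_pow_pow)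
      finally have M: "a [^] (d * int e * i) = b0 [^] (int e * d * (j' - j))" .
      have "a [^] \<bar>d * int e * i\<bar> = b0 [^] (sgn i * (int e * d * (j' - j)))"
      proof (cases "i > 0")
        case True then show ?thesis using M d e by (simp add: abs_mult)
      next
        case False
        then have "a [^] \<bar>d * int e * i\<bar> = inv (a [^] (d * int e * i))"
          using d e aG by (simp add: abs_mult int_pow_neg[symmetric])
        then show ?thesis using False i0 M b0G by (simp add: int_pow_neg[symmetric] sgn_if)
      qed
      then have "a [^] nat \<bar>d * int e * i\<bar> = b0 [^] (sgn i * (int e * d * (j' - j)))"
        by (metis abs_ge_zero int_nat_eq int_pow_int)
      then show ?thesis using d e i0 by (intro exI[of _ "nat \<bar>d * int e * i\<bar>"]) auto
    qed
    then show ?thesis using b0G by blast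
  qed
  then obtain b0 where b0: "b0 \<in> carrier G"
    and ex: "\<And>a. a \<in> ?B \<Longrightarrow> \<exists>M>(0::nat). \<exists>L::int. a [^] M = b0 [^] L" by blast
  have "\<exists>M>(0::nat). \<forall>a\<in>?B. a \<in> ?B \<and> (\<exists>L::int. a [^] M = b0 [^] L)"
  proof (rule finite_common_multiple[OF B(1)])
    fix a assume "a \<in> ?B"
    then show "\<exists>M>(0::nat). a \<in> ?B \<and> (\<exists>L::int. a [^] M = b0 [^] L)" using ex by blast
  next
    fix a and M k :: nat assume "a \<in> ?B \<and> (\<exists>L::int. a [^] M = b0 [^] L)"
    then obtain L :: int where a: "a \<in> ?B" "a [^] M = b0 [^] L" by blast
    then have "a [^] (M * k) = b0 [^] (L * int k)"
      using B b0 by (auto simp flip: nat_pow_pow simp: nat_pow_int_pow)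
    then show "a \<in> ?B \<and> (\<exists>L::int. a [^] (M * k) = b0 [^] L)" using a by blast
  qed
  then obtain M where M: "M > (0::nat)" and root_M: "\<And>a. a \<in> ?B \<Longrightarrow> \<exists>L::int. a [^] M = b0 [^] L" by blast
  let ?F = "(\<lambda>((f, b), r). f \<otimes> b [^] (r::int)) ` (P \<times> {0..<int M})"
  have "\<exists>k::int. \<exists>x\<in>?F. a = b0 [^] k \<otimes> x" if a: "a \<in> carrier G" for a
  proof -
    obtain f b and k :: int where fb: "(f, b) \<in> P" "a = f \<otimes> b [^] k" using cover a by blast
    have fG: "f \<in> carrier G" and bG: "b \<in> carrier G" using fb(1) P by auto
    obtain L :: int where L: "b [^] M = b0 [^] L" using root_M fb(1) by force
    have "b [^] k = b [^] (int M * (k div int M) + k mod int M)" by simp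
    also have "\<dots> = (b [^] M) [^] (k div int M) \<otimes> b [^] (k mod int M)"
      using bG by (simp only: int_pow_mult int_pow_pow flip: int_pow_int)
    also have "\<dots> = b0 [^] (L * (k div int M)) \<otimes> b [^] (k mod int M)"
      using b0 by (simp add: L int_pow_pow)
    finally have "a = b0 [^] (L * (k div int M)) \<otimes> (f \<otimes> b [^] (k mod int M))"
      using fb(2) fG bG b0 by (simp add: m_ac)
    moreover have "f \<otimes> b [^] (k mod int M) \<in> ?F"
      using fb(1) M by (intro image_eqI[of _ _ "((f, b), k mod int M)"]) auto
    ultimately show ?thesis by blast
  qed
  moreover have "?F \<subseteq> carrier G" "finite ?F" using P by auto
  ultimately show ?thesis using b0 unfolding cyclic_by_finite_def by blast
qed

section \<open>Groups covered by conjugates of virtually cyclic subgroups\<close>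

definition conjugates_cover :: "('a, 'b) monoid_scheme \<Rightarrow> 'a set set \<Rightarrow> bool" where
  "conjugates_cover G VV \<longleftrightarrow> finite VV \<and> (\<forall>V\<in>VV. subgroup V G \<and> cyclic_by_finite G V) \<and>
     (\<forall>g\<in>carrier G. \<exists>V\<in>VV. \<exists>v\<in>V. \<exists>x\<in>carrier G. g = x \<otimes>\<^bsub>G\<^esub> v \<otimes>\<^bsub>G\<^esub> inv\<^bsub>G\<^esub> x)"

lemma (in group) conjugation_group_hom:
  assumes "x \<in> carrier G" shows "group_hom G G (\<lambda>v. x \<otimes> v \<otimes> inv x)"
proof -
  have "x \<otimes> (a \<otimes> b) \<otimes> inv x = x \<otimes> a \<otimes> inv x \<otimes> (x \<otimes> b \<otimes> inv x)"
    if "a \<in> carrier G" "b \<in> carrier G" for a b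
    using assms that by (simp add: m_assoc inv_cancel_left)
  then show ?thesis using assms
    by (intro group_hom.intro group_hom_axioms.intro is_group) (auto simp: hom_def)
qed

text \<open>The hypothesis says that \<open>w\<close> and \<open>t\<^sup>n\<close> are equal in the quotient by \<open>N\<close>.\<close>
lemma (in group) power_in_normal_iff:
  assumes N: "N \<lhd> G" and w: "w \<in> carrier G" and t: "t \<in> carrier G" and wt: "w \<otimes> inv (t [^] (n::int)) \<in> N"
  shows "w [^] (i::int) \<in> N \<longleftrightarrow> t [^] (n * i) \<in> N"
proof -
  interpret N: normal N G by (rule N)
  have Ns: "subgroup N G" by (rule N.subgroup_axioms)
  have "w = (w \<otimes> inv (t [^] n)) \<otimes> t [^] n" using w t by (simp add: m_assoc)
  then have "w \<in> N #> t [^] n" using wt unfolding r_coset_def by blast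
  then have "N #> w = N #> t [^] n" using repr_independence[of w N "t [^] n"] t Ns by simp
  then have "N #> w [^] i = N #> t [^] (n * i)"
    using N.FactGroup_int_pow[OF w, of i] N.FactGroup_int_pow[of "t [^] n" i] t by (simp add: int_pow_pow)
  then show ?thesis
    using coset_join1[OF _ _ Ns] coset_join2[OF _ Ns] w t by (metis int_pow_closed)
qed

text \<open>Some power of \<open>w\<close> lies in \<open>\<langle>c\<rangle>\<close>, the cyclic part of \<open>V\<close>. As \<open>w\<close> has infinite order modulo \<open>N\<close>, so does
  \<open>c\<close>, and each of the finitely many cosets \<open>\<langle>c\<rangle>f\<close> contains at most one element of \<open>N\<close>.\<close>
lemma (in group) finite_intersection_with_normal:
  assumes N: "N \<lhd> G" and V: "subgroup V G" "cyclic_by_finite G V"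
    and t: "t \<in> carrier G" and inf: "\<And>i::int. t [^] i \<in> N \<Longrightarrow> i = 0"
    and w: "w \<in> V" "w \<otimes> inv (t [^] (n::int)) \<in> N" "n \<noteq> 0"
  shows "finite (V \<inter> N)"
proof -
  have Ns: "subgroup N G" using N normal_imp_subgroup by blast
  have VG: "V \<subseteq> carrier G" using V(1) subgroup.subset by blast
  obtain c F where c: "c \<in> V" and F: "F \<subseteq> V" "finite F"
    and cF: "\<And>v. v \<in> V \<Longrightarrow> \<exists>k::int. \<exists>f\<in>F. v = c [^] k \<otimes> f"
    using V(2) unfolding cyclic_by_finite_def by blast
  have cG: "c \<in> carrier G" and wG: "w \<in> carrier G" using c w(1) VG by auto
  obtain e :: nat and l :: int where e: "e > 0" "w [^] e = c [^] l"
    using power_in_cyclic_part[OF V(1) c F(2,1) cF w(1)] by blast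
  have c_inf: "k = 0" if k: "c [^] k \<in> N" for k :: int
  proof -
    have "w [^] (int e * k) = (w [^] e) [^] k" using wG by (simp add: int_pow_int flip: int_pow_pow)
    also have "\<dots> = (c [^] k) [^] l" using cG by (simp add: e(2) int_pow_pow mult.commute)
    also have "\<dots> \<in> N" using k Ns subgroup_int_pow_closed by blast
    finally have "t [^] (n * (int e * k)) \<in> N" using power_in_normal_iff[OF N wG t w(2)] by blast
    then show ?thesis using inf e(1) w(3) by fastforce
  qed
  have "inj_on (\<lambda>v. SOME f. f \<in> F \<and> (\<exists>k::int. v = c [^] k \<otimes> f)) (V \<inter> N)" (is "inj_on ?f _")
  proof (rule inj_onI)
    fix u v assume uv: "u \<in> V \<inter> N" "v \<in> V \<inter> N" "?f u = ?f v"
    have ex: "\<exists>f. f \<in> F \<and> (\<exists>k::int. x = c [^] k \<otimes> f)" if "x \<in> V" for x using cF[OF that] by blast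
    obtain k :: int where k: "u = c [^] k \<otimes> ?f u" using someI_ex[OF ex[of u]] uv(1) by blast
    obtain l :: int where l: "v = c [^] l \<otimes> ?f u" using someI_ex[OF ex[of v]] uv by auto
    have "?f u \<in> F" using someI_ex[OF ex[of u]] uv(1) by blast
    then have fG: "?f u \<in> carrier G" using F VG by blast
    have "u \<otimes> inv v \<in> N" using uv Ns by (simp add: subgroup.m_closed subgroup.m_inv_closed)
    moreover have "u \<otimes> inv v = c [^] (k - l)"
      using quotient_cancel[of "c [^] k" "c [^] l" "?f u"] cG fG k l by (simp add: int_pow_diff)
    ultimately have "k = l" using c_inf by fastforce
    then show "u = v" using k l by metis
  qed
  moreover have "?f ` (V \<inter> N) \<subseteq> F"
  proof
    fix y assume "y \<in> ?f ` (V \<inter> N)"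
    then obtain v where v: "v \<in> V" "y = ?f v" by blast
    have "\<exists>f. f \<in> F \<and> (\<exists>k::int. v = c [^] k \<otimes> f)" using cF[OF v(1)] by blast
    from someI_ex[OF this] show "y \<in> F" using v by blast
  qed
  ultimately show ?thesis using F(2) by (meson finite_imageD finite_subset)
qed

lemma (in group) conjugate_by_factor:
  assumes "x \<in> carrier G" "y \<in> carrier G" "v \<in> carrier G"
  shows "inv x \<otimes> ((x \<otimes> y) \<otimes> v \<otimes> inv (x \<otimes> y)) \<otimes> x = y \<otimes> v \<otimes> inv y"
  using assms by (simp add: inv_mult_group m_assoc inv_cancel_left)

text \<open>If the conjugating element is \<open>a t\<^sup>k f\<close>, the part \<open>f\<close> can be absorbed into the virtually cyclic
  subgroup, at the price of replacing each \<open>V\<close> by its finitely many conjugates \<open>f V f\<^sup>-\<^sup>1\<close>. So the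
  conjugating elements may be taken in \<open>A\<langle>t\<rangle>\<close>.\<close>
lemma (in group) conjugates_cover_up_to_cosets:
  assumes A: "A \<subseteq> carrier G" and t: "t \<in> carrier G" and F: "finite F" "F \<subseteq> carrier G"
    and AtF: "\<And>g. g \<in> carrier G \<Longrightarrow> \<exists>a\<in>A. \<exists>k::int. \<exists>f\<in>F. g = a \<otimes> t [^] k \<otimes> f"
    and VV: "conjugates_cover G VV"
  shows "\<exists>WW. finite WW \<and> (\<forall>W\<in>WW. subgroup W G \<and> cyclic_by_finite G W) \<and>
    (\<forall>g\<in>carrier G. \<exists>W\<in>WW. \<exists>a\<in>A. \<exists>k::int. inv (a \<otimes> t [^] k) \<otimes> g \<otimes> (a \<otimes> t [^] k) \<in> W)"
proof -
  let ?conj = "\<lambda>f V. (\<lambda>v. f \<otimes> v \<otimes> inv f) ` V"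
  define WW where "WW = (\<lambda>(f, V). ?conj f V) ` (F \<times> VV)"
  have finVV: "finite VV" and VVs: "\<And>V. V \<in> VV \<Longrightarrow> subgroup V G \<and> cyclic_by_finite G V"
    and VVc: "\<And>g. g \<in> carrier G \<Longrightarrow> \<exists>V\<in>VV. \<exists>v\<in>V. \<exists>x\<in>carrier G. g = x \<otimes> v \<otimes> inv x"
    using VV unfolding conjugates_cover_def by blast+
  have "finite WW" using finVV F by (simp add: WW_def)
  moreover have "subgroup W G \<and> cyclic_by_finite G W" if W: "W \<in> WW" for W
  proof -
    obtain f V where f: "f \<in> F" "V \<in> VV" "W = ?conj f V"
      using W by (auto simp: WW_def)
    interpret h: group_hom G G "\<lambda>v. f \<otimes> v \<otimes> inv f" using conjugation_group_hom f(1) F by blast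
    show ?thesis unfolding f(3)
      using h.subgroup_img_is_subgroup h.cyclic_by_finite_image VVs[OF f(2)] subgroup.subset by blast
  qed
  moreover have "\<exists>W\<in>WW. \<exists>a\<in>A. \<exists>k::int. inv (a \<otimes> t [^] k) \<otimes> g \<otimes> (a \<otimes> t [^] k) \<in> W"
    if g: "g \<in> carrier G" for g
  proof -
    obtain V v x where V: "V \<in> VV" "v \<in> V" "x \<in> carrier G" "g = x \<otimes> v \<otimes> inv x"
      using VVc[OF g] by blast
    obtain a k f where x: "a \<in> A" "f \<in> F" "x = a \<otimes> t [^] (k::int) \<otimes> f" using AtF[OF V(3)] by blast
    have vG: "v \<in> carrier G" and fG: "f \<in> carrier G" and aG: "a \<otimes> t [^] k \<in> carrier G"
      using subgroup.mem_carrier[of V G v] V(1,2) VVs F x A t by auto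
    have "inv (a \<otimes> t [^] k) \<otimes> g \<otimes> (a \<otimes> t [^] k) = f \<otimes> v \<otimes> inv f"
      using conjugate_by_factor[OF aG fG vG] V(4) x(3) by simp
    then have inV: "inv (a \<otimes> t [^] k) \<otimes> g \<otimes> (a \<otimes> t [^] k) \<in> ?conj f V" using V(2) by simp
    have "?conj f V \<in> WW" unfolding WW_def using x(2) V(1) by force
    then show ?thesis by (rule bexI[rotated], intro bexI[OF _ x(1)] exI) (rule inV)
  qed
  ultimately show ?thesis by (intro exI[of _ WW] conjI ballI) simp_all
qed

text \<open>Each \<open>W \<inter> A\<close> is again virtually cyclic, hence a finite union of cosets \<open>f\<langle>b\<rangle>\<close>.\<close>
lemma (in group) pairs_for_intersections:
  assumes As: "subgroup A G" and comm: "\<And>x y. \<lbrakk>x \<in> A; y \<in> A\<rbrakk> \<Longrightarrow> x \<otimes> y = y \<otimes> x"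
    and WW: "finite WW" "\<And>W. W \<in> WW \<Longrightarrow> subgroup W G \<and> cyclic_by_finite G W"
  shows "\<exists>P. finite P \<and> P \<subseteq> A \<times> A \<and>
    (\<forall>(f, b)\<in>P. \<exists>e>(0::nat). \<exists>i::int. f [^] e = b [^] i) \<and>
    (\<forall>W\<in>WW. \<forall>v\<in>W \<inter> A. \<exists>(f, b)\<in>P. \<exists>k::int. v = f \<otimes> b [^] k)"
proof -
  have WA: "cyclic_by_finite G (W \<inter> A)" "subgroup (W \<inter> A) G" if "W \<in> WW" for W
  proof -
    have W: "subgroup W G" "cyclic_by_finite G W" using WW(2)[OF that] by auto
    show s: "subgroup (W \<inter> A) G" using W(1) As subgroups_Inter_pair by blast
    show "cyclic_by_finite G (W \<inter> A)"
      by (rule cyclic_by_finite_subgroup[OF subgroup.subset[OF W(1)] W(2) s]) auto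
  qed
  have "\<forall>W\<in>WW. \<exists>c F'. c \<in> W \<inter> A \<and> F' \<subseteq> W \<inter> A \<and> finite F' \<and>
      (\<forall>v\<in>W \<inter> A. \<exists>k::int. \<exists>f\<in>F'. v = c [^] k \<otimes> f)"
    using WA(1) unfolding cyclic_by_finite_def by blast
  then obtain c F' where c: "\<And>W. W \<in> WW \<Longrightarrow> c W \<in> W \<inter> A"
    and F': "\<And>W. W \<in> WW \<Longrightarrow> F' W \<subseteq> W \<inter> A" "\<And>W. W \<in> WW \<Longrightarrow> finite (F' W)"
    and cF': "\<And>W v. \<lbrakk>W \<in> WW; v \<in> W \<inter> A\<rbrakk> \<Longrightarrow> \<exists>k::int. \<exists>f\<in>F' W. v = c W [^] k \<otimes> f" by metis
  define P where "P = (\<Union>W\<in>WW. (\<lambda>f. (f, c W)) ` F' W)"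
  have "finite P" "P \<subseteq> A \<times> A" using WW(1) F' c by (auto simp: P_def)
  moreover have "\<exists>(f, b)\<in>P. \<exists>k::int. v = f \<otimes> b [^] k" if v: "W \<in> WW" "v \<in> W \<inter> A" for W v
  proof -
    obtain k :: int and f where f: "f \<in> F' W" "v = c W [^] k \<otimes> f" using cF'[OF v] by blast
    have fA: "f \<in> A" and cA: "c W \<in> A" using f(1) F'(1)[OF v(1)] c[OF v(1)] by auto
    have "c W [^] k \<in> A" using cA As subgroup_int_pow_closed by blast
    then have "v = f \<otimes> c W [^] k" using f(2) fA comm by simp
    moreover have "(f, c W) \<in> P" using f(1) v(1) by (auto simp: P_def)
    ultimately show ?thesis by blast
  qed
  moreover have "\<exists>e>(0::nat). \<exists>i::int. f [^] e = b [^] i" if fb: "(f, b) \<in> P" for f b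
  proof -
    obtain W where W: "W \<in> WW" "f \<in> F' W" "b = c W" using fb by (auto simp: P_def)
    have "f \<in> W \<inter> A" using W F' by blast
    then show ?thesis
      using power_in_cyclic_part[OF WA(2)[OF W(1)] c[OF W(1)] F'(2,1)[OF W(1)] cF'[OF W(1)]] W(3) by blast
  qed
  ultimately show ?thesis by (intro exI[of _ P]) blast
qed

text \<open>Conjugation by elements of \<open>A\<close> is trivial on \<open>A\<close>. So \<open>A\<close> itself, and not only the union of its
  conjugates, is covered by finitely many virtually cyclic groups \<open>W \<inter> A\<close>.\<close>
lemma (in group) abelian_normal_finite_index:
  assumes A: "A \<lhd> G" and comm: "\<And>x y. \<lbrakk>x \<in> A; y \<in> A\<rbrakk> \<Longrightarrow> x \<otimes> y = y \<otimes> x"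
    and F: "finite F" "F \<subseteq> carrier G"
    and AF: "\<And>g. g \<in> carrier G \<Longrightarrow> \<exists>a\<in>A. \<exists>f\<in>F. g = a \<otimes> f"
    and VV: "conjugates_cover G VV"
  shows "cyclic_by_finite G (carrier G)"
proof -
  have As: "subgroup A G" using A normal_imp_subgroup by blast
  have AG: "A \<subseteq> carrier G" using As subgroup.subset by blast
  let ?A = "G\<lparr>carrier := A\<rparr>"
  interpret A: group ?A using As subgroup.subgroup_is_group is_group by blast
  interpret A: comm_group ?A
    by (intro A.group_comm_groupI) (simp add: comm)
  have A_int_pow: "x [^]\<^bsub>?A\<^esub> (k::int) = x [^] k" if "x \<in> A" for x k
    using int_pow_consistent[OF As that] by simp
  have A_nat_pow: "x [^]\<^bsub>?A\<^esub> (k::nat) = x [^] k" for x k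
    using nat_pow_consistent by metis
  have "\<exists>a\<in>A. \<exists>k::int. \<exists>f\<in>F. g = a \<otimes> \<one> [^] k \<otimes> f" if g: "g \<in> carrier G" for g
  proof -
    obtain a f where a: "a \<in> A" "f \<in> F" "g = a \<otimes> f" using AF[OF g] by blast
    then have "g = a \<otimes> \<one> [^] (0::int) \<otimes> f" using AG by auto
    then show ?thesis using a by blast
  qed
  \<comment> \<open>The case \<open>t = \<one>\<close>, in which the conjugating elements are in \<open>A\<close>.\<close>
  then obtain WW where WW: "finite WW" "\<And>W. W \<in> WW \<Longrightarrow> subgroup W G \<and> cyclic_by_finite G W"
    and WWc: "\<And>g. g \<in> carrier G \<Longrightarrow> \<exists>W\<in>WW. \<exists>a\<in>A. \<exists>k::int. inv (a \<otimes> \<one> [^] k) \<otimes> g \<otimes> (a \<otimes> \<one> [^] k) \<in> W"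
    using conjugates_cover_up_to_cosets[OF AG one_closed F _ VV] by metis
  obtain P where P: "finite P" "P \<subseteq> A \<times> A" "\<forall>(f, b)\<in>P. \<exists>e>(0::nat). \<exists>i::int. f [^] e = b [^] i"
    and PW: "\<forall>W\<in>WW. \<forall>v\<in>W \<inter> A. \<exists>(f, b)\<in>P. \<exists>k::int. v = f \<otimes> b [^] k"
    using pairs_for_intersections[OF As comm WW] by blast
  have "cyclic_by_finite ?A (carrier ?A)"
  proof (rule A.cyclic_by_finite_if_covered)
    show "finite P" "P \<subseteq> carrier ?A \<times> carrier ?A" using P by auto
    show "\<exists>e>(0::nat). \<exists>i::int. f [^]\<^bsub>?A\<^esub> e = b [^]\<^bsub>?A\<^esub> i" if "(f, b) \<in> P" for f b
      using that P(2,3) by (auto simp: A_int_pow A_nat_pow subset_iff)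
    show "\<forall>a\<in>carrier ?A. \<exists>(f, b)\<in>P. \<exists>k::int. a = f \<otimes>\<^bsub>?A\<^esub> b [^]\<^bsub>?A\<^esub> k"
    proof
      fix a assume a: "a \<in> carrier ?A"
      then have aG: "a \<in> carrier G" using AG by auto
      obtain W b where W: "W \<in> WW" "b \<in> A" "inv b \<otimes> a \<otimes> b \<in> W"
        using WWc[OF aG] AG by fastforce
      have "inv b \<otimes> a \<otimes> b = a"
        using comm[of a b] W(2) a aG AG by (auto simp: m_assoc inv_cancel_left)
      then have "a \<in> W \<inter> A" using W a by simp
      then obtain f b and k :: int where "(f, b) \<in> P" "a = f \<otimes> b [^] k" using PW W(1) by blast
      moreover have "b \<in> A" using \<open>(f, b) \<in> P\<close> P(2) by auto
      ultimately have "a = f \<otimes>\<^bsub>?A\<^esub> b [^]\<^bsub>?A\<^esub> k" using A_int_pow by simp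
      then show "\<exists>(f, b)\<in>P. \<exists>k::int. a = f \<otimes>\<^bsub>?A\<^esub> b [^]\<^bsub>?A\<^esub> k"
        using \<open>(f, b) \<in> P\<close> by blast
    qed
  qed
  then obtain c F' where c: "c \<in> A" and F': "F' \<subseteq> A" "finite F'"
    and cF': "\<And>v. v \<in> A \<Longrightarrow> \<exists>k::int. \<exists>f\<in>F'. v = c [^] k \<otimes> f"
    unfolding cyclic_by_finite_def using A_int_pow by auto
  let ?F = "(\<lambda>(x, y). x \<otimes> y) ` (F' \<times> F)"
  have "\<exists>k::int. \<exists>f\<in>?F. g = c [^] k \<otimes> f" if g: "g \<in> carrier G" for g
  proof -
    obtain a f where a: "a \<in> A" "f \<in> F" "g = a \<otimes> f" using AF[OF g] by blast
    obtain k :: int and f' where f': "f' \<in> F'" "a = c [^] k \<otimes> f'" using cF'[OF a(1)] by blast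
    have "f' \<in> carrier G" "c \<in> carrier G" "f \<in> carrier G" using f'(1) F' c a(2) F AG by auto
    then have "g = c [^] k \<otimes> (f' \<otimes> f)" using a(3) f'(2) by (simp add: m_assoc)
    then show ?thesis using f'(1) a(2) by blast
  qed
  moreover have "finite ?F" "?F \<subseteq> carrier G" using F F' AG by auto
  ultimately show ?thesis using c AG unfolding cyclic_by_finite_def by blast
qed

text \<open>Here \<open>\<tau>\<^sup>k\<close> is conjugation by \<open>t\<^sup>k\<close>. An element \<open>a t\<^sup>n\<close> with \<open>n \<ge> 1\<close> is conjugate under \<open>b t\<^sup>k\<close> to some
  \<open>r t\<^sup>n \<in> W\<close>. Additively this reads \<open>a = \<tau>\<^sup>kr + (\<tau>\<^sup>n - 1)(-b)\<close>, so the possible \<open>r\<close> represent the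
  orbits of \<open>\<tau>\<close> on \<open>A/(\<tau>\<^sup>n - 1)A\<close>. For given \<open>W\<close> and \<open>n\<close> they form a coset of \<open>W \<inter> A\<close>, which is finite because
  \<open>W\<close> contains an element of infinite order modulo \<open>A\<close>. The sum of the orders of the finite groups
  \<open>W \<inter> A\<close> is a bound \<open>N\<close> that does not depend on \<open>n\<close>.\<close>
lemma (in group) abelian_normal_infinite_cyclic_quotient:
  assumes A: "A \<lhd> G" and comm: "\<And>x y. \<lbrakk>x \<in> A; y \<in> A\<rbrakk> \<Longrightarrow> x \<otimes> y = y \<otimes> x"
    and t: "t \<in> carrier G" and inf: "\<And>i::int. t [^] i \<in> A \<Longrightarrow> i = 0"
    and F: "finite F" "F \<subseteq> carrier G"
    and AtF: "\<And>g. g \<in> carrier G \<Longrightarrow> \<exists>a\<in>A. \<exists>k::int. \<exists>f\<in>F. g = a \<otimes> t [^] k \<otimes> f"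
    and VV: "conjugates_cover G VV"
  shows "finite A"
proof -
  have As: "subgroup A G" using A normal_imp_subgroup by blast
  have AG: "A \<subseteq> carrier G" using As subgroup.subset by blast
  let ?A = "G\<lparr>carrier := A\<rparr>"
  interpret A: group ?A using As subgroup.subgroup_is_group is_group by blast
  interpret A: comm_group ?A
    by (intro A.group_comm_groupI) (simp add: comm)
  have A_int_pow: "x [^]\<^bsub>?A\<^esub> (k::int) = x [^] k" if "x \<in> A" for x k
    using int_pow_consistent[OF As that] by simp
  have A_nat_pow: "x [^]\<^bsub>?A\<^esub> (k::nat) = x [^] k" for x k
    using nat_pow_consistent by metis
  have A_inv: "inv\<^bsub>?A\<^esub> x = inv x" if "x \<in> A" for x
    using m_inv_consistent[OF As that] by simp
  have tG: "t [^] (k::int) \<in> carrier G" for k using t by simp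
  have conj: "x \<otimes> a \<otimes> inv x \<in> A" if "x \<in> carrier G" "a \<in> A" for x a
    using normal.inv_op_closed2[OF A that] .
  define \<tau> where "\<tau> k x = t [^] (k::int) \<otimes> x \<otimes> inv (t [^] k)" for k x
  interpret act: int_action ?A \<tau>
  proof
    fix n show "\<tau> n \<in> hom ?A ?A"
      using group_hom.hom_mult[OF conjugation_group_hom[OF tG]] conj[OF tG] AG
      by (auto simp: hom_def \<tau>_def subset_iff)
  next
    fix x assume "x \<in> carrier ?A" then show "\<tau> 0 x = x" using AG by (auto simp: \<tau>_def)
  next
    fix x m n assume "x \<in> carrier ?A" then show "\<tau> (m + n) x = \<tau> m (\<tau> n x)"
      using AG t by (auto simp: \<tau>_def int_pow_mult inv_mult_group m_assoc)
  qed
  have \<tau>A: "\<tau> n x \<in> A" if "x \<in> A" for n x using act.act_closed that by simp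
  obtain WW where WW: "finite WW" "\<And>W. W \<in> WW \<Longrightarrow> subgroup W G \<and> cyclic_by_finite G W"
    and WWc: "\<And>g. g \<in> carrier G \<Longrightarrow> \<exists>W\<in>WW. \<exists>a\<in>A. \<exists>k::int. inv (a \<otimes> t [^] k) \<otimes> g \<otimes> (a \<otimes> t [^] k) \<in> W"
    using conjugates_cover_up_to_cosets[OF AG t F AtF VV] by metis
  obtain P where P: "finite P" "P \<subseteq> A \<times> A" "\<forall>(f, b)\<in>P. \<exists>e>(0::nat). \<exists>i::int. f [^] e = b [^] i"
    and PW: "\<forall>W\<in>WW. \<forall>v\<in>W \<inter> A. \<exists>(f, b)\<in>P. \<exists>k::int. v = f \<otimes> b [^] k"
    using pairs_for_intersections[OF As comm WW] by blast
  define WW' where "WW' = {W \<in> WW. finite (W \<inter> A)}"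
  define N where "N = (\<Sum>W\<in>WW'. card (W \<inter> A))"
  have finWW': "finite WW'" using WW(1) by (simp add: WW'_def)
  have "finite (carrier ?A)"
  proof (rule act.finite_if_cyclic_cover_and_few_orbits)
    show "finite P" "P \<subseteq> carrier ?A \<times> carrier ?A" using P by auto
    show "\<exists>e>(0::nat). \<exists>i::int. f [^]\<^bsub>?A\<^esub> e = b [^]\<^bsub>?A\<^esub> i" if "(f, b) \<in> P" for f b
      using that P(2,3) by (auto simp: A_int_pow A_nat_pow subset_iff)
    show "\<forall>a\<in>carrier ?A. \<exists>(f, b)\<in>P. \<exists>n. \<exists>k::int. a = \<tau> n (f \<otimes>\<^bsub>?A\<^esub> b [^]\<^bsub>?A\<^esub> k)"
    proof
      fix a assume a: "a \<in> carrier ?A"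
      then have aA: "a \<in> A" and aG: "a \<in> carrier G" using AG by auto
      obtain W b k where W: "W \<in> WW" "b \<in> A" "inv (b \<otimes> t [^] (k::int)) \<otimes> a \<otimes> (b \<otimes> t [^] k) \<in> W"
        using WWc[OF aG] by blast
      have bG: "b \<in> carrier G" using W(2) AG by auto
      have ba: "inv b \<otimes> (a \<otimes> b) = a"
        using comm[OF aA W(2)] aG bG by (simp add: inv_cancel_left)
      have "inv (b \<otimes> t [^] k) \<otimes> a \<otimes> (b \<otimes> t [^] k) = inv (t [^] k) \<otimes> (inv b \<otimes> (a \<otimes> b)) \<otimes> t [^] k"
        using aG bG tG by (simp add: inv_mult_group m_assoc)
      also have "\<dots> = \<tau> (- k) a" using t by (simp add: ba \<tau>_def int_pow_neg)
      finally have "\<tau> (- k) a \<in> W \<inter> A" using W(3) \<tau>A[OF aA] by simp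
      then obtain f c and j :: int where fc: "(f, c) \<in> P" "\<tau> (- k) a = f \<otimes> c [^] j" using PW W(1) by blast
      have "c \<in> A" using fc(1) P(2) by auto
      then have "a = \<tau> k (f \<otimes>\<^bsub>?A\<^esub> c [^]\<^bsub>?A\<^esub> j)"
        using act.act_neg_cancel(2)[OF a, of k] by (simp add: fc(2) A_int_pow)
      then show "\<exists>(f, b)\<in>P. \<exists>n. \<exists>k::int. a = \<tau> n (f \<otimes>\<^bsub>?A\<^esub> b [^]\<^bsub>?A\<^esub> k)" using fc(1) by blast
    qed
    fix n :: nat assume n: "n > 0"
    let ?s = "t [^] int n"
    have sG: "?s \<in> carrier G" using t by simp
    define S where "S W = {r \<in> A. r \<otimes> ?s \<in> W}" for W
    have S: "finite (S W) \<and> card (S W) \<le> card (W \<inter> A)" if W: "W \<in> WW'" for W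
    proof (cases "S W = {}")
      case False
      then obtain r0 where r0: "r0 \<in> A" "r0 \<otimes> ?s \<in> W" by (auto simp: S_def)
      have Ws: "subgroup W G" and fin: "finite (W \<inter> A)" using W WW(2) by (auto simp: WW'_def)
      have r0G: "r0 \<in> carrier G" using r0 AG by auto
      have inj: "inj_on (\<lambda>r. r \<otimes> inv r0) (S W)"
        using AG r0G by (auto simp: inj_on_def S_def subset_iff)
      have sub: "(\<lambda>r. r \<otimes> inv r0) ` S W \<subseteq> W \<inter> A"
      proof
        fix y assume "y \<in> (\<lambda>r. r \<otimes> inv r0) ` S W"
        then obtain r where r: "r \<in> A" "r \<otimes> ?s \<in> W" "y = r \<otimes> inv r0" by (auto simp: S_def)
        have "y = (r \<otimes> ?s) \<otimes> inv (r0 \<otimes> ?s)" using quotient_cancel[of r r0 ?s] r AG r0G sG by auto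
        then have "y \<in> W" using r(2) r0(2) Ws by (simp add: subgroup.m_closed subgroup.m_inv_closed)
        moreover have "y \<in> A" using r(1,3) r0(1) As by (simp add: subgroup.m_closed subgroup.m_inv_closed)
        ultimately show "y \<in> W \<inter> A" by simp
      qed
      show ?thesis using inj sub fin by (meson card_inj_on_le inj_on_finite)
    qed simp
    let ?R = "\<Union>W\<in>WW'. S W"
    have "card ?R \<le> (\<Sum>W\<in>WW'. card (S W))" by (rule card_UN_le[OF finWW'])
    also have "\<dots> \<le> N" unfolding N_def using S by (intro sum_mono) auto
    finally have "card ?R \<le> N" .
    moreover have "finite ?R" using finWW' S by blast
    moreover have "?R \<subseteq> carrier ?A" by (auto simp: S_def)
    moreover have "\<exists>r\<in>?R. \<exists>j. \<exists>d\<in>act.displacements (int n). a = \<tau> j r \<otimes>\<^bsub>?A\<^esub> d"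
      if a: "a \<in> carrier ?A" for a
    proof -
      have aA: "a \<in> A" and aG: "a \<in> carrier G" using a AG by auto
      obtain W b k where W: "W \<in> WW" "b \<in> A"
        "inv (b \<otimes> t [^] (k::int)) \<otimes> (a \<otimes> ?s) \<otimes> (b \<otimes> t [^] k) \<in> W"
        using WWc[of "a \<otimes> ?s"] aG sG by blast
      let ?w = "inv (b \<otimes> t [^] k) \<otimes> (a \<otimes> ?s) \<otimes> (b \<otimes> t [^] k)" and ?u = "t [^] k"
      have bG: "b \<in> carrier G" and binv: "inv b \<in> A" using W(2) AG As by (auto simp: subgroup.m_inv_closed)
      let ?y = "inv b \<otimes> a \<otimes> \<tau> (int n) b"
      have yA: "?y \<in> A" using binv aA \<tau>A[OF W(2)] As by (simp add: subgroup.m_closed)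
      have yG: "?y \<in> carrier G" using yA AG by auto
      let ?r = "\<tau> (- k) ?y"
      have rA: "?r \<in> A" using \<tau>A[OF yA] .
      \<comment> \<open>Conjugating \<open>a t\<^sup>n\<close> by \<open>b t\<^sup>k\<close> gives \<open>r t\<^sup>n\<close> with \<open>r\<close> in \<open>A\<close>, because \<open>t\<^sup>k\<close> and \<open>t\<^sup>n\<close> commute.\<close>
      have us: "?u \<otimes> ?s = ?s \<otimes> ?u" using t by (simp add: add.commute flip: int_pow_mult)
      have uG: "?u \<in> carrier G" using t by simp
      have "?r \<otimes> ?s = inv ?u \<otimes> (inv b \<otimes> (a \<otimes> (?s \<otimes> (b \<otimes> (inv ?s \<otimes> (?u \<otimes> ?s))))))"
        using t aG bG by (simp add: \<tau>_def int_pow_neg m_assoc)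
      also have "\<dots> = inv ?u \<otimes> (inv b \<otimes> (a \<otimes> (?s \<otimes> (b \<otimes> ?u))))"
        using sG uG by (simp add: us inv_cancel_left)
      also have "\<dots> = ?w" using aG bG sG uG by (simp add: inv_mult_group m_assoc)
      finally have w: "?r \<otimes> ?s = ?w" .
      have wW: "?r \<otimes> ?s \<in> W" using W(3) w by simp
      have "(?r \<otimes> ?s) \<otimes> inv (t [^] int n) \<in> A"
        using rA AG sG by (auto simp: m_assoc subset_iff)
      then have "finite (W \<inter> A)"
        using finite_intersection_with_normal[OF A _ _ t inf wW] WW(2)[OF W(1)] n by simp
      then have "?r \<in> ?R" using W(1) rA wW by (auto simp: WW'_def S_def)
      moreover have "a = \<tau> k ?r \<otimes>\<^bsub>?A\<^esub> act.\<delta> (int n) (inv b)"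
      proof -
        have "\<tau> k ?r = ?y" using act.act_neg_cancel(2)[of ?y k] yA by simp
        moreover have "act.\<delta> (int n) (inv b) = \<tau> (int n) (inv b) \<otimes> b"
          using binv bG by (simp add: act.\<delta>_def A_inv)
        moreover have "?y \<otimes> (\<tau> (int n) (inv b) \<otimes> b) = inv b \<otimes> (a \<otimes> b)"
          using aG bG sG by (simp add: \<tau>_def m_assoc inv_cancel_left)
        moreover have "inv b \<otimes> (a \<otimes> b) = a"
          using comm[OF aA W(2)] aG bG by (simp add: inv_cancel_left)
        ultimately show ?thesis by simp
      qed
      moreover have "act.\<delta> (int n) (inv b) \<in> act.displacements (int n)"
        using binv by (simp add: act.displacements_def)
      ultimately show ?thesis by blast
    qed
    ultimately show "\<exists>R. finite R \<and> card R \<le> N \<and> R \<subseteq> carrier ?A \<and>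
        (\<forall>a\<in>carrier ?A. \<exists>r\<in>R. \<exists>j. \<exists>d\<in>act.displacements (int n). a = \<tau> j r \<otimes>\<^bsub>?A\<^esub> d)"
      by blast
  qed
  then show ?thesis by simp
qed

text \<open>The hypothesis \<open>AtF\<close> says that \<open>G/A\<close> is virtually cyclic. If a power of \<open>t\<close> lies in \<open>A\<close>, then \<open>A\<close> has
  finite index. Otherwise \<open>A\<close> is finite, and \<open>\<langle>t\<rangle>\<close> has finite index.\<close>
lemma (in group) abelian_extension_of_cyclic_by_finite:
  assumes A: "A \<lhd> G" and comm: "\<And>x y. \<lbrakk>x \<in> A; y \<in> A\<rbrakk> \<Longrightarrow> x \<otimes> y = y \<otimes> x"
    and t: "t \<in> carrier G" and F: "finite F" "F \<subseteq> carrier G"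
    and AtF: "\<And>g. g \<in> carrier G \<Longrightarrow> \<exists>a\<in>A. \<exists>k::int. \<exists>f\<in>F. g = a \<otimes> t [^] k \<otimes> f"
    and VV: "conjugates_cover G VV"
  shows "cyclic_by_finite G (carrier G)"
proof -
  have As: "subgroup A G" using A normal_imp_subgroup by blast
  have AG: "A \<subseteq> carrier G" using As subgroup.subset by blast
  show ?thesis
  proof (cases "\<exists>m>0. t [^] (m::int) \<in> A")
    case True
    then obtain m :: int where m: "m > 0" "t [^] m \<in> A" by blast
    let ?F = "(\<lambda>(k, f). t [^] (k::int) \<otimes> f) ` ({0..<m} \<times> F)"
    have AF: "\<exists>a\<in>A. \<exists>f\<in>?F. g = a \<otimes> f" if g: "g \<in> carrier G" for g
    proof -
      obtain a k f where x: "a \<in> A" "f \<in> F" "g = a \<otimes> t [^] (k::int) \<otimes> f" using AtF[OF g] by blast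
      have "t [^] k = t [^] (m * (k div m) + k mod m)" by simp
      also have "\<dots> = (t [^] m) [^] (k div m) \<otimes> t [^] (k mod m)"
        using t by (simp only: int_pow_mult int_pow_pow)
      finally have "g = (a \<otimes> (t [^] m) [^] (k div m)) \<otimes> (t [^] (k mod m) \<otimes> f)"
        using x t AG F by (auto simp: m_assoc subset_iff)
      moreover have "a \<otimes> (t [^] m) [^] (k div m) \<in> A"
        using x(1) m(2) As by (simp add: subgroup.m_closed subgroup_int_pow_closed)
      moreover have "t [^] (k mod m) \<otimes> f \<in> ?F"
        using x(2) m by (intro image_eqI[of _ _ "(k mod m, f)"]) auto
      ultimately show ?thesis by blast
    qed
    have "finite ?F" "?F \<subseteq> carrier G" using F t by auto
    then show ?thesis using abelian_normal_finite_index[OF A comm _ _ AF VV] by blast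
  next
    case False
    have "i = 0" if "t [^] i \<in> A" for i :: int
    proof (rule ccontr)
      assume "i \<noteq> 0"
      moreover have "t [^] (- i) \<in> A" using that As t by (simp add: int_pow_neg subgroup.m_inv_closed)
      ultimately show False using False that by (metis linorder_neqE_linordered_idom neg_0_less_iff_less)
    qed
    then have finA: "finite A"
      using abelian_normal_infinite_cyclic_quotient[OF A comm t _ F AtF VV] by blast
    let ?F = "(\<lambda>(a, f). a \<otimes> f) ` (A \<times> F)"
    have "\<exists>k::int. \<exists>f\<in>?F. g = t [^] k \<otimes> f" if g: "g \<in> carrier G" for g
    proof -
      obtain a k f where x: "a \<in> A" "f \<in> F" "g = a \<otimes> t [^] (k::int) \<otimes> f" using AtF[OF g] by blast
      have "a \<in> carrier G" "f \<in> carrier G" using x AG F by auto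
      then have "g = t [^] k \<otimes> ((inv (t [^] k) \<otimes> a \<otimes> t [^] k) \<otimes> f)"
        using x(3) t by (simp add: m_assoc inv_cancel_left)
      moreover have "inv (t [^] k) \<otimes> a \<otimes> t [^] k \<in> A"
        using normal.inv_op_closed1[OF A _ x(1)] t by simp
      ultimately show ?thesis using x(2) by blast
    qed
    moreover have "finite ?F" "?F \<subseteq> carrier G" using finA F AG by auto
    ultimately show ?thesis using t unfolding cyclic_by_finite_def by blast
  qed
qed

lemma (in normal) cyclic_by_finite_quotientD:
  assumes "cyclic_by_finite (G Mod H) (carrier (G Mod H))"
  shows "\<exists>t\<in>carrier G. \<exists>F\<subseteq>carrier G. finite F \<and>
    (\<forall>g\<in>carrier G. \<exists>a\<in>H. \<exists>k::int. \<exists>f\<in>F. g = a \<otimes> t [^] k \<otimes> f)"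
proof -
  obtain C FF where C: "C \<in> carrier (G Mod H)" and FF: "FF \<subseteq> carrier (G Mod H)" "finite FF"
    and CF: "\<forall>v\<in>carrier (G Mod H). \<exists>k::int. \<exists>f\<in>FF. v = C [^]\<^bsub>G Mod H\<^esub> k \<otimes>\<^bsub>G Mod H\<^esub> f"
    using assms unfolding cyclic_by_finite_def by blast
  obtain t where t: "t \<in> carrier G" "C = H #> t" using C by (auto simp: carrier_FactGroup)
  obtain F where F: "F \<subseteq> carrier G" "finite F" "FF = (\<lambda>x. H #> x) ` F"
    using FF finite_subset_image[of FF "\<lambda>x. H #> x" "carrier G"] by (auto simp: carrier_FactGroup)
  have "\<exists>a\<in>H. \<exists>k::int. \<exists>f\<in>F. g = a \<otimes> t [^] k \<otimes> f" if g: "g \<in> carrier G" for g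
  proof -
    obtain k :: int and f where f: "f \<in> F" "H #> g = (H #> t) [^]\<^bsub>G Mod H\<^esub> k \<otimes>\<^bsub>G Mod H\<^esub> (H #> f)"
      using CF[rule_format, of "H #> g"] g t F by (auto simp: carrier_FactGroup)
    have fG: "f \<in> carrier G" using f F by blast
    have "H #> g = H #> (t [^] k \<otimes> f)"
      using f(2) FactGroup_int_pow[OF t(1), of k] rcos_sum[of "t [^] k" f] t fG by simp
    then have "g \<in> H #> (t [^] k \<otimes> f)" using rcos_self[OF g] subgroup_axioms by blast
    then obtain a where "a \<in> H" "g = a \<otimes> (t [^] k \<otimes> f)" by (auto simp: r_coset_def)
    then have "g = a \<otimes> t [^] k \<otimes> f" using t fG by (simp add: m_assoc)
    then show ?thesis using \<open>a \<in> H\<close> f(1) by blast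
  qed
  then show ?thesis using t F by blast
qed

lemma (in group_hom) conjugates_cover_image:
  assumes surj: "h ` carrier G = carrier H" and VV: "conjugates_cover G VV"
  shows "conjugates_cover H ((`) h ` VV)"
proof -
  have VVs: "\<And>V. V \<in> VV \<Longrightarrow> subgroup V G \<and> cyclic_by_finite G V"
    and VVc: "\<And>g. g \<in> carrier G \<Longrightarrow> \<exists>V\<in>VV. \<exists>v\<in>V. \<exists>x\<in>carrier G. g = x \<otimes> v \<otimes> inv x"
    using VV unfolding conjugates_cover_def by blast+
  have "\<exists>V\<in>(`) h ` VV. \<exists>v\<in>V. \<exists>x\<in>carrier H. y = x \<otimes>\<^bsub>H\<^esub> v \<otimes>\<^bsub>H\<^esub> inv\<^bsub>H\<^esub> x" if y: "y \<in> carrier H" for y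
  proof -
    obtain g where g: "g \<in> carrier G" "y = h g" using y surj by blast
    obtain V v x where V: "V \<in> VV" "v \<in> V" "x \<in> carrier G" "g = x \<otimes> v \<otimes> inv x"
      using VVc[OF g(1)] by blast
    have "v \<in> carrier G" using V VVs subgroup.mem_carrier by metis
    then have "y = h x \<otimes>\<^bsub>H\<^esub> h v \<otimes>\<^bsub>H\<^esub> inv\<^bsub>H\<^esub> h x" using g V by simp
    then show ?thesis
      using V by (intro bexI[of _ "h ` V"] bexI[of _ "h v"] bexI[of _ "h x"]) auto
  qed
  moreover have "subgroup (h ` V) H \<and> cyclic_by_finite H (h ` V)" if "V \<in> VV" for V
    using VVs[OF that] subgroup_img_is_subgroup cyclic_by_finite_image subgroup.subset by blast
  ultimately show ?thesis using VV unfolding conjugates_cover_def by auto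
qed

text \<open>The induction runs over the quotients \<open>G/D k\<close> of the fixed group \<open>G\<close> by the terms of its derived
  series. All of these groups have the same type, whereas an induction on the derived length that
  passes from \<open>G\<close> to a quotient would change the type of the group. In the step from \<open>k\<close> to \<open>k + 1\<close> the
  abelian normal subgroup is \<open>D k/D (k + 1)\<close>.\<close>
theorem (in group) solvable_conjugates_cover_imp_cyclic_by_finite:
  assumes sol: "solvable G" and VV: "conjugates_cover G VV"
  shows "cyclic_by_finite G (carrier G)"
proof -
  define D where "D k = (derived G ^^ k) (carrier G)" for k
  have D_normal: "D k \<lhd> G" for k
    by (induction k) (auto simp: D_def normal_self derived_is_normal)
  have quot: "cyclic_by_finite (G Mod D k) (carrier (G Mod D k))" for k
  proof (induction k)
    case 0
    interpret N: normal "carrier G" G by (rule normal_self)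
    interpret Q: group "G Mod carrier G" by (rule N.factorgroup_is_group)
    have "carrier (G Mod carrier G) = {\<one>\<^bsub>G Mod carrier G\<^esub>}"
      using coset_join2[OF _ subgroup_self] one_closed by (auto simp: carrier_FactGroup)
    then have "cyclic_by_finite (G Mod carrier G) (carrier (G Mod carrier G))"
      unfolding cyclic_by_finite_def
      by (intro bexI[of _ "\<one>\<^bsub>G Mod carrier G\<^esub>"] exI[of _ "{\<one>\<^bsub>G Mod carrier G\<^esub>}"]) (auto simp del: one_FactGroup mult_FactGroup)
    then show ?case by (simp add: D_def)
  next
    case (Suc k)
    interpret N: normal "D (Suc k)" G by (rule D_normal)
    interpret Q: group "G Mod D (Suc k)" by (rule N.factorgroup_is_group)
    let ?Q = "G Mod D (Suc k)" and ?\<pi> = "\<lambda>x. D (Suc k) #> x"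
    interpret \<pi>: group_hom G ?Q ?\<pi>
      by (intro group_hom.intro group_hom_axioms.intro is_group Q.is_group N.r_coset_hom_Mod)
    have surj: "?\<pi> ` carrier G = carrier ?Q" by (simp add: carrier_FactGroup)
    obtain t F where t: "t \<in> carrier G" and F: "F \<subseteq> carrier G" "finite F"
      and DtF: "\<forall>g\<in>carrier G. \<exists>a\<in>D k. \<exists>k::int. \<exists>f\<in>F. g = a \<otimes> t [^] k \<otimes> f"
      using normal.cyclic_by_finite_quotientD[OF D_normal Suc] by blast
    have DG: "D k \<subseteq> carrier G" using D_normal normal_imp_subgroup subgroup.subset by blast
    show ?case
    proof (rule Q.abelian_extension_of_cyclic_by_finite)
      show "?\<pi> ` D k \<lhd> ?Q"
        by (rule normal.surj_hom_normal_subgroup[OF D_normal \<pi>.group_hom_axioms surj])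
      show "x \<otimes>\<^bsub>?Q\<^esub> y = y \<otimes>\<^bsub>?Q\<^esub> x" if xy: "x \<in> ?\<pi> ` D k" "y \<in> ?\<pi> ` D k" for x y
      proof -
        obtain a b where ab: "a \<in> D k" "b \<in> D k" "x = ?\<pi> a" "y = ?\<pi> b" using xy by blast
        have abG: "a \<in> carrier G" "b \<in> carrier G" using ab DG by auto
        have "a \<otimes> b \<otimes> inv a \<otimes> inv b \<in> derived_set G (D k)" using ab by blast
        then have "a \<otimes> b \<otimes> inv a \<otimes> inv b \<in> D (Suc k)"
          by (simp add: D_def derived_def generate.incl)
        then have "?\<pi> (a \<otimes> b \<otimes> inv a \<otimes> inv b) = \<one>\<^bsub>?Q\<^esub>"
          using coset_join2[OF _ N.subgroup_axioms] abG by simp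
        moreover have "a \<otimes> b = (a \<otimes> b \<otimes> inv a \<otimes> inv b) \<otimes> (b \<otimes> a)"
          using abG by (simp add: m_assoc inv_cancel_left)
        ultimately have "?\<pi> (a \<otimes> b) = ?\<pi> (b \<otimes> a)"
          using \<pi>.hom_mult[of "a \<otimes> b \<otimes> inv a \<otimes> inv b" "b \<otimes> a"] abG
          by (metis Q.l_one \<pi>.hom_closed inv_closed m_closed)
        then show ?thesis using abG ab \<pi>.hom_mult by metis
      qed
      show "?\<pi> t \<in> carrier ?Q" using t by simp
      show "finite (?\<pi> ` F)" "?\<pi> ` F \<subseteq> carrier ?Q" using F by auto
      show "conjugates_cover ?Q ((`) ?\<pi> ` VV)" by (rule \<pi>.conjugates_cover_image[OF surj VV])
      show "\<exists>a\<in>?\<pi> ` D k. \<exists>k::int. \<exists>f\<in>?\<pi> ` F. y = a \<otimes>\<^bsub>?Q\<^esub> ?\<pi> t [^]\<^bsub>?Q\<^esub> k \<otimes>\<^bsub>?Q\<^esub> f"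
        if y: "y \<in> carrier ?Q" for y
      proof -
        obtain g where g: "g \<in> carrier G" "y = ?\<pi> g" using y by (auto simp: carrier_FactGroup)
        obtain a f and j :: int where a: "a \<in> D k" "f \<in> F" "g = a \<otimes> t [^] j \<otimes> f" using DtF g(1) by blast
        then have "y = ?\<pi> a \<otimes>\<^bsub>?Q\<^esub> ?\<pi> t [^]\<^bsub>?Q\<^esub> j \<otimes>\<^bsub>?Q\<^esub> ?\<pi> f"
          using g(2) t DG F \<pi>.hom_int_pow[OF t, of j] by (auto simp: subset_iff simp del: mult_FactGroup)
        then show ?thesis using a by blast
      qed
    qed
  qed
  obtain n where n: "D n = {\<one>}" using sol solvable_iff_trivial_derived_seq by (auto simp: D_def)
  obtain t F where t: "t \<in> carrier G" and F: "F \<subseteq> carrier G" "finite F"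
    and DtF: "\<forall>g\<in>carrier G. \<exists>a\<in>D n. \<exists>k::int. \<exists>f\<in>F. g = a \<otimes> t [^] k \<otimes> f"
    using normal.cyclic_by_finite_quotientD[OF D_normal quot[of n]] by blast
  have "\<exists>k::int. \<exists>f\<in>F. g = t [^] k \<otimes> f" if g: "g \<in> carrier G" for g
    using DtF[rule_format, OF g] n t by auto
  then show ?thesis using t F unfolding cyclic_by_finite_def by blast
qed

section \<open>From Bredon modules to coverings\<close>

lemma (in group) coset_action:
  assumes C: "subgroup C G"
  defines "\<phi> \<equiv> \<lambda>g. \<lambda>K\<in>lcosets C. g <# K"
  shows "transitive_action G (lcosets C) \<phi>"
    and "\<And>x. x \<in> carrier G \<Longrightarrow> stabilizer G \<phi> (x <# C) = (\<lambda>c. x \<otimes> c \<otimes> inv x) ` C"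
proof -
  have CG: "C \<subseteq> carrier G" using C subgroup.subset by blast
  have KG: "K \<subseteq> carrier G" if "K \<in> lcosets C" for K
    using that lcosets_subset_PowG[OF C] by blast
  have mem: "g <# K \<in> lcosets C" if "g \<in> carrier G" "K \<in> lcosets C" for g K
    using that CG lcos_m_assoc[OF CG] by (auto simp: LCOSETS_def)
  have one: "\<one> <# K = K" if "K \<in> lcosets C" for K
    using lcos_mult_one KG[OF that] by blast
  have mult: "g <# (h <# K) = (g \<otimes> h) <# K" if "g \<in> carrier G" "h \<in> carrier G" "K \<in> lcosets C" for g h K
    using lcos_m_assoc[OF KG[OF that(3)] that(1,2)] .
  have Bij: "\<phi> g \<in> Bij (lcosets C)" if g: "g \<in> carrier G" for g
  proof -
    have "bij_betw (\<lambda>K. g <# K) (lcosets C) (lcosets C)"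
      by (rule bij_betw_byWitness[of _ "\<lambda>K. inv g <# K"])
        (use g mem mult one in auto)
    then show ?thesis unfolding \<phi>_def Bij_def by (simp cong: bij_betw_cong)
  qed
  have hom: "group_hom G (BijGroup (lcosets C)) \<phi>"
  proof (intro group_hom.intro group_hom_axioms.intro is_group group_BijGroup homI)
    show "\<phi> g \<in> carrier (BijGroup (lcosets C))" if "g \<in> carrier G" for g
      using Bij[OF that] by (simp add: BijGroup_def)
    show "\<phi> (g \<otimes> h) = \<phi> g \<otimes>\<^bsub>BijGroup (lcosets C)\<^esub> \<phi> h" if gh: "g \<in> carrier G" "h \<in> carrier G" for g h
      using Bij[OF gh(1)] Bij[OF gh(2)] mem mult gh
      by (auto simp: BijGroup_def \<phi>_def compose_def fun_eq_iff)
  qed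
  show "transitive_action G (lcosets C) \<phi>"
  proof (intro transitive_action.intro group_action.intro transitive_action_axioms.intro hom)
    fix x y assume "x \<in> lcosets C" "y \<in> lcosets C"
    then obtain a b where ab: "a \<in> carrier G" "x = a <# C" "b \<in> carrier G" "y = b <# C"
      by (auto simp: LCOSETS_def)
    have "\<phi> (b \<otimes> inv a) x = y"
      using ab \<open>x \<in> lcosets C\<close> lcos_m_assoc[OF CG, of "b \<otimes> inv a" a]
      by (simp add: \<phi>_def m_assoc)
    then show "\<exists>g\<in>carrier G. \<phi> g x = y" using ab by blast
  qed
  show "stabilizer G \<phi> (x <# C) = (\<lambda>c. x \<otimes> c \<otimes> inv x) ` C" if x: "x \<in> carrier G" for x
  proof -
    have xC: "x <# C \<in> lcosets C" using x by (auto simp: LCOSETS_def)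
    have "g <# (x <# C) = x <# C \<longleftrightarrow> inv x \<otimes> g \<otimes> x \<in> C" if g: "g \<in> carrier G" for g
    proof -
      have e: "g <# (x <# C) = (g \<otimes> x) <# C" using lcos_m_assoc[OF CG g x] .
      show ?thesis
      proof
        assume "g <# (x <# C) = x <# C"
        then have "g \<otimes> x \<in> x <# C" using e lcos_self[of "g \<otimes> x" C] C g x by auto
        then show "inv x \<otimes> g \<otimes> x \<in> C"
          using CG x g by (auto simp: l_coset_def m_assoc inv_cancel_left subset_iff)
      next
        assume "inv x \<otimes> g \<otimes> x \<in> C"
        then have "x \<otimes> (inv x \<otimes> g \<otimes> x) \<in> x <# C" by (auto simp: l_coset_def)
        then have "g \<otimes> x \<in> x <# C" using x g by (simp add: m_assoc inv_cancel_left)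
        then show "g <# (x <# C) = x <# C" using l_repr_independence[OF _ x C] e by metis
      qed
    qed
    then have "stabilizer G \<phi> (x <# C) = {g \<in> carrier G. inv x \<otimes> g \<otimes> x \<in> C}"
      using xC by (auto simp: stabilizer_def \<phi>_def)
    also have "\<dots> = (\<lambda>c. x \<otimes> c \<otimes> inv x) ` C"
    proof (intro equalityI subsetI)
      fix g assume g: "g \<in> {g \<in> carrier G. inv x \<otimes> g \<otimes> x \<in> C}"
      then have "g = x \<otimes> (inv x \<otimes> g \<otimes> x) \<otimes> inv x" using x by (simp add: m_assoc inv_cancel_left)
      then show "g \<in> (\<lambda>c. x \<otimes> c \<otimes> inv x) ` C" using g by blast
    next
      fix g assume "g \<in> (\<lambda>c. x \<otimes> c \<otimes> inv x) ` C"
      then show "g \<in> {g \<in> carrier G. inv x \<otimes> g \<otimes> x \<in> C}"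
        using x CG by (auto simp: m_assoc inv_cancel_left subset_iff)
    qed
    finally show ?thesis .
  qed
qed

lemma (in group) virtually_cyclic_cyclic_subgroup:
  assumes C: "subgroup C G" and c: "c \<in> C" "C = range (\<lambda>k::int. c [^] k)"
  shows "C \<in> vc_subgroups G"
proof -
  interpret C: group "G\<lparr>carrier := C\<rparr>" using C subgroup.subgroup_is_group is_group by blast
  have "cyclic_by_finite (G\<lparr>carrier := C\<rparr>) (carrier (G\<lparr>carrier := C\<rparr>))"
  proof -
    have "\<exists>k::int. \<exists>f\<in>{\<one>}. v = c [^]\<^bsub>G\<lparr>carrier := C\<rparr>\<^esub> k \<otimes> f" if "v \<in> C" for v
    proof -
      obtain k :: int where "v = c [^] k" using \<open>v \<in> C\<close> c(2) by blast
      then have "v = c [^]\<^bsub>G\<lparr>carrier := C\<rparr>\<^esub> k \<otimes> \<one>"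
        using int_pow_consistent[OF C c(1), of k] subgroup.mem_carrier[OF C \<open>v \<in> C\<close>] by simp
      then show ?thesis by blast
    qed
    then show ?thesis
      unfolding cyclic_by_finite_def using c(1) subgroup.one_closed[OF C]
      by (intro bexI[of _ c] exI[of _ "{\<one>}"]) auto
  qed
  then show ?thesis
    using C.cyclic_by_finite_imp_virtually_cyclic C by (simp add: vc_subgroups_def)
qed

text \<open>Without \<open>G\<close>-maps \<open>D \<rightarrow> W\<close> the group \<open>\<int>[D,W]\<close> is trivial, and so is its direct summand \<open>P(D)\<close>, which
  then cannot map onto \<open>\<int>\<close>.\<close>
lemma fg_projective_onto_const_imp_gmap:
  fixes W :: "('g, 'w) gset"
  assumes epi: "e \<in> bmod_epi G F P const_bmod" and summand: "bmod_summand G F P (free_bmod G W)"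
    and P: "bredon_module G F P" and D: "D \<in> orbit_objs G F"
  shows "gmaps G D W \<noteq> {}"
proof
  assume empty: "gmaps G D W = {}"
  have PD: "group (val P D)" using P D by (auto simp: bredon_module_def comm_group_def)
  obtain P' :: "('g, ('g set \<Rightarrow> 'w) \<Rightarrow>\<^sub>0 int) bmod" and t where P': "bredon_module G F P'" and t: "t \<in> bmod_iso G F (bmod_sum P P') (free_bmod G W)"
    using summand unfolding bmod_summand_def by blast
  have P'D: "group (val P' D)" using P' D by (auto simp: bredon_module_def comm_group_def)
  have "t D \<in> iso (val (bmod_sum P P') D) (val (free_bmod G W) D)"
    using t D unfolding bmod_iso_def by blast
  then have bij: "bij_betw (t D) (carrier (val P D) \<times> carrier (val P' D)) (carrier (free_Abelian_group (gmaps G D W)))"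
    by (simp add: iso_def bmod_sum_def free_bmod_def DirProd_def)
  have triv: "carrier (free_Abelian_group (gmaps G D W)) \<subseteq> {0}"
    by (auto simp: empty)
  have "e D ` carrier (val P D) = (UNIV :: int set)"
    using epi D by (auto simp: bmod_epi_def const_bmod_def)
  then have "0 \<in> e D ` carrier (val P D)" "1 \<in> e D ` carrier (val P D)" by simp_all
  then obtain x y where xy: "x \<in> carrier (val P D)" "y \<in> carrier (val P D)" "e D x = 0" "e D y = 1"
    by (elim imageE) (metis that)
  let ?o = "\<one>\<^bsub>val P' D\<^esub>"
  have o: "?o \<in> carrier (val P' D)" using P'D group.is_monoid monoid.one_closed by blast
  have "t D z = 0" if "z \<in> carrier (val P D) \<times> carrier (val P' D)" for z
    using bij_betw_apply[OF bij that] triv by blast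
  then have "t D (x, ?o) = t D (y, ?o)" using xy o by simp
  then have "x = y" using bij xy o by (auto simp: bij_betw_def inj_on_def)
  then show False using xy by simp
qed

text \<open>A \<open>G\<close>-map from \<open>G/\<langle>g\<rangle>\<close> to \<open>W\<close> takes the coset \<open>\<langle>g\<rangle>\<close> to a point that is fixed by \<open>g\<close>. That point lies in the
  orbit of a chosen representative \<open>r\<close>, so \<open>g\<close> is conjugate to an element of the stabiliser of \<open>r\<close>.\<close>
lemma (in group) bredon_FP_infty_imp_conjugates_cover:
  assumes "bredon_FP_infty TYPE('w) TYPE('m) G (vc_subgroups G)"
  shows "\<exists>VV. conjugates_cover G VV"
proof -
  let ?F = "vc_subgroups G"
  obtain P :: "nat \<Rightarrow> ('a, 'm) bmod" and d e where res: "bmod_resolution G ?F P d e"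
    and fg: "\<forall>i. bmod_fg_projective TYPE('w) G ?F (P i)"
    using assms unfolding bredon_FP_infty_def by blast
  have epi: "e \<in> bmod_epi G ?F (P 0) const_bmod" using res by (simp add: bmod_resolution_def)
  have "bmod_fg_projective TYPE('w) G ?F (P 0)" using fg by blast
  then obtain W :: "('a, 'w) gset" where W: "gset_over G ?F W" "finite (orbits G (fst W) (snd W))"
    and summand: "bmod_summand G ?F (P 0) (free_bmod G W)"
    and proj: "bmod_projective G ?F (P 0)"
    unfolding bmod_fg_projective_def by blast
  have mod: "bredon_module G ?F (P 0)" using proj by (simp add: bmod_projective_def)
  interpret W: group_action G "fst W" "snd W" using W(1) by (simp add: gset_over_def)
  let ?rep = "\<lambda>K. SOME w. w \<in> K"
  define VV where "VV = (\<lambda>K. stabilizer G (snd W) (?rep K)) ` orbits G (fst W) (snd W)"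
  have rep: "?rep (orbit G (snd W) w) \<in> orbit G (snd W) w" if "w \<in> fst W" for w
    using W.orbit_refl[OF that] by (rule someI)
  have orbW: "orbit G (snd W) w \<subseteq> fst W" if "w \<in> fst W" for w
    using W.element_image that by (auto simp: orbit_def)
  have "subgroup V G \<and> cyclic_by_finite G V" if V: "V \<in> VV" for V
  proof -
    obtain w where w: "w \<in> fst W" "V = stabilizer G (snd W) (?rep (orbit G (snd W) w))"
      using V by (auto simp: VV_def orbits_def)
    then have "?rep (orbit G (snd W) w) \<in> fst W" using rep orbW by blast
    then have "V \<in> ?F" using W(1) w(2) by (simp add: gset_over_def)
    then show ?thesis using virtually_cyclic_imp_cyclic_by_finite by (simp add: vc_subgroups_def)
  qed
  moreover have "\<exists>V\<in>VV. \<exists>v\<in>V. \<exists>x\<in>carrier G. g = x \<otimes> v \<otimes> inv x" if g: "g \<in> carrier G" for g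
  proof -
    let ?C = "generate G {g}"
    have C: "subgroup ?C G" using g generate_is_subgroup by simp
    have Cpow: "?C = range (\<lambda>k::int. g [^] k)" using generate_pow[OF g] by auto
    have gC: "g \<in> ?C" by (simp add: generate.incl)
    have CG: "?C \<subseteq> carrier G" using C subgroup.subset by blast
    define \<phi> where "\<phi> = (\<lambda>h. \<lambda>K\<in>lcosets ?C. h <# K)"
    let ?D = "(lcosets ?C, \<phi>)"
    have trans: "transitive_action G (lcosets ?C) \<phi>"
      unfolding \<phi>_def by (rule coset_action(1)[OF C])
    interpret D: transitive_action G "lcosets ?C" \<phi> by (rule trans)
    have stab: "stabilizer G \<phi> (x <# ?C) \<in> ?F" if x: "x \<in> carrier G" for x
    proof -
      interpret h: group_hom G G "\<lambda>v. x \<otimes> v \<otimes> inv x" by (rule conjugation_group_hom[OF x])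
      let ?S = "(\<lambda>v. x \<otimes> v \<otimes> inv x) ` ?C"
      have "?S = range (\<lambda>k::int. (x \<otimes> g \<otimes> inv x) [^] k)"
        unfolding Cpow image_image using h.hom_int_pow[OF g] by simp
      then have "?S \<in> ?F"
        using virtually_cyclic_cyclic_subgroup[of ?S "x \<otimes> g \<otimes> inv x"] h.subgroup_img_is_subgroup[OF C] gC by blast
      then show ?thesis using coset_action(2)[OF C x] by (simp add: \<phi>_def)
    qed
    have "?D \<in> orbit_objs G ?F"
      using trans stab D.group_action_axioms subgroup.subset[OF C]
      by (auto simp: orbit_objs_def gset_over_def LCOSETS_def)
    then obtain f where f: "f \<in> gmaps G ?D W"
      using fg_projective_onto_const_imp_gmap[OF epi summand mod] by blast
    have oneC: "\<one> <# ?C = ?C" using lcos_mult_one CG by blast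
    have C0: "?C \<in> lcosets ?C" using oneC one_closed by (force simp: LCOSETS_def)
    let ?w = "f ?C"
    have w: "?w \<in> fst W" using f C0 by (auto simp: gmaps_def)
    have "\<phi> g ?C = ?C" using C0 coset_join3[OF g C gC] by (simp add: \<phi>_def)
    moreover have "f (\<phi> g ?C) = snd W g ?w" using f C0 g by (simp add: gmaps_def)
    ultimately have fix_w: "snd W g ?w = ?w" by simp
    let ?K = "orbit G (snd W) ?w"
    let ?r = "?rep ?K"
    have r: "?r \<in> ?K" "?r \<in> fst W" using rep[OF w] orbW[OF w] by auto
    then obtain x where x: "x \<in> carrier G" "?r = snd W x ?w" by (auto simp: orbit_def)
    have xr: "snd W (inv x) ?r = ?w" using W.orbit_sym_aux[OF x(1) w] x(2) by simp
    let ?v = "x \<otimes> g \<otimes> inv x"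
    have "snd W ?v ?r = snd W x (snd W g (snd W (inv x) ?r))"
      using W.composition_rule r(2) x(1) g W.element_image by (metis inv_closed m_closed)
    also have "\<dots> = ?r" using xr fix_w x(2) by simp
    finally have "?v \<in> stabilizer G (snd W) ?r" using x(1) g by (simp add: stabilizer_def)
    moreover have "stabilizer G (snd W) ?r \<in> VV" using w by (auto simp: VV_def orbits_def)
    moreover have "g = inv x \<otimes> ?v \<otimes> inv (inv x)" using x(1) g by (simp add: m_assoc inv_cancel_left)
    ultimately show ?thesis using x(1) by (meson inv_closed)
  qed
  moreover have "finite VV" using W(2) by (simp add: VV_def)
  ultimately show ?thesis
    unfolding conjugates_cover_def by (intro exI[of _ VV] conjI ballI) simp_all
qed

theorem theorem5p1:
  fixes G :: "('g, 'b) monoid_scheme"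
  assumes "group G"
    and "solvable G"
    and "bredon_FP_infty TYPE('w) TYPE('m) G (vc_subgroups G)"
    and "\<And>g. g \<in> carrier G \<Longrightarrow> group.ord G g = 0 \<Longrightarrow>
           FP_infty TYPE('n) (G\<lparr>carrier := centralizer G g\<rparr>)"
  shows "virtually_cyclic G"
proof -
  interpret group G by fact
  obtain VV where "conjugates_cover G VV"
    using bredon_FP_infty_imp_conjugates_cover[OF assms(3)] by blast
  then have "cyclic_by_finite G (carrier G)"
    by (rule solvable_conjugates_cover_imp_cyclic_by_finite[OF assms(2)])
  then show ?thesis by (rule cyclic_by_finite_imp_virtually_cyclic)
qed

end
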